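(* Let $G$ be a regular decorated cycle: a unicyclic graph with cycle of length $g$ in which every cycle vertex has the same degree $d$ and carries the same (isomorphic) rooted pendant tree. Then the Perron eigenvector $w^\ast$ of the Ricci matrix $R_G$ is constant on the cycle edges, so the condition that every three consecutive cycle edges have total $w^\ast$-weight at most half of the cycle perimeter reads $3\le g/2$. Hence for girth $g\ge6$ the weighting $w^\ast$ is a discrete Einstein metric with curvature $\kappa=-\lambda_{\max}(R_G)$, for every $d$ and every such decoration.
   Context: Weighted graphs: $G=(V,E)$ is a finite connected simple graph, $w:E\to\mathbb{R}_{>0}$ an edge weighting, $d_v$ the combinatorial degree, and $d(x,y)$ the least total weight of a path from $x$ to $y$. Lin--Lu--Yau curvature: for $\alpha\in[0,1]$ let $\mu_x^\alpha$ be the probability measure with mass $\alpha$ at $x$ and $(1-\alpha)/d_x$ at each neighbour of $x$. Let $W$ be the $L^1$-Wasserstein distance with respect to $d$. For an edge $x\sim y$ put $\kappa_\alpha(x,y)=1-W(\mu_x^\alpha,\mu_y^\alpha)/d(x,y)$ and $\kappa_{xy}=\lim_{\alpha\to1}\kappa_\alpha(x,y)/(1-\alpha)$. A positive weighting $w$ is a discrete Einstein metric of curvature $\kappa$ if $\kappa_e=\kappa$ for every edge $e$. Ricci matrix: $R_G\in\mathbb{R}^{E\times E}$ has diagonal entries $-(1/d_x+1/d_y)$ for $e=\{x,y\}$, entry $1/d_z$ for $e\ne e'$ with $e\cap e'=\{z\}$, and $0$ for disjoint edges. $\lambda_{\max}(R_G)$ is its largest eigenvalue and $w^\ast>0$ the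 corresponding (Perron) eigenvector, unique up to scaling. Unicyclic: connected with $|E|=|V|$, i.e. a cycle with rooted trees (possibly trivial) attached at cycle vertices. *)

theory Defs
  imports "HOL-Probability.Probability"
begin

section \<open>Finite simple graphs with edges as two-element vertex sets\<close>

definition simple_graph :: "'a set \<Rightarrow> 'a set set \<Rightarrow> bool" where
  "simple_graph V E \<longleftrightarrow> finite V \<and> V \<noteq> {} \<and> (\<forall>e\<in>E. e \<subseteq> V \<and> card e = 2)"

definition neighbours :: "'a set set \<Rightarrow> 'a \<Rightarrow> 'a set" where
  "neighbours E x = {y. {x, y} \<in> E}"

definition degree :: "'a set set \<Rightarrow> 'a \<Rightarrow> nat" where
  "degree E x = card (neighbours E x)"

definition is_path :: "'a set \<Rightarrow> 'a set set \<Rightarrow> 'a \<Rightarrow> 'a \<Rightarrow> 'a list \<Rightarrow> bool" where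
  "is_path V E x y p \<longleftrightarrow> p \<noteq> [] \<and> set p \<subseteq> V \<and> hd p = x \<and> last p = y \<and> distinct p \<and>
     successively (\<lambda>u v. {u, v} \<in> E) p"

definition connected_graph :: "'a set \<Rightarrow> 'a set set \<Rightarrow> bool" where
  "connected_graph V E \<longleftrightarrow> (\<forall>x\<in>V. \<forall>y\<in>V. \<exists>p. is_path V E x y p)"

definition unicyclic :: "'a set \<Rightarrow> 'a set set \<Rightarrow> bool" where
  "unicyclic V E \<longleftrightarrow> simple_graph V E \<and> connected_graph V E \<and> card E = card V"


section \<open>Weighted distance, Wasserstein distance and Lin--Lu--Yau curvature\<close>

text \<open>A weighting is a function on all vertex sets; only its values on edges matter.\<close>

definition path_weight :: "('a set \<Rightarrow> real) \<Rightarrow> 'a list \<Rightarrow> real" where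
  "path_weight w p = (\<Sum>i<length p - 1. w {p ! i, p ! Suc i})"

definition wdist :: "'a set \<Rightarrow> 'a set set \<Rightarrow> ('a set \<Rightarrow> real) \<Rightarrow> 'a \<Rightarrow> 'a \<Rightarrow> real" where
  "wdist V E w x y = Min {path_weight w p | p. is_path V E x y p}"

definition wasserstein :: "('a \<Rightarrow> 'a \<Rightarrow> real) \<Rightarrow> 'a pmf \<Rightarrow> 'a pmf \<Rightarrow> real" where
  "wasserstein \<delta> \<mu> \<nu> =
     Inf {measure_pmf.expectation \<pi> (\<lambda>(u, v). \<delta> u v) | \<pi>.
            map_pmf fst \<pi> = \<mu> \<and> map_pmf snd \<pi> = \<nu>}"

text \<open>With probability \<open>\<alpha>\<close> stay at \<open>x\<close>, otherwise move to a uniformly random neighbour.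
  This is meant for \<open>\<alpha>\<close> in the unit interval and vertices \<open>x\<close> of positive degree.\<close>

definition lazy_walk :: "'a set set \<Rightarrow> real \<Rightarrow> 'a \<Rightarrow> 'a pmf" where
  "lazy_walk E \<alpha> x =
     bind_pmf (bernoulli_pmf \<alpha>)
       (\<lambda>stay. if stay then return_pmf x else pmf_of_set (neighbours E x))"

definition alpha_curvature ::
  "'a set \<Rightarrow> 'a set set \<Rightarrow> ('a set \<Rightarrow> real) \<Rightarrow> real \<Rightarrow> 'a \<Rightarrow> 'a \<Rightarrow> real" where
  "alpha_curvature V E w \<alpha> x y =
     1 - wasserstein (wdist V E w) (lazy_walk E \<alpha> x) (lazy_walk E \<alpha> y) / wdist V E w x y"

text \<open>Stated as convergence, so that existence of the limit is part of the assertion.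
  The limit is one-sided because \<open>\<alpha>\<close> ranges over the unit interval.\<close>

definition has_lly_curvature ::
  "'a set \<Rightarrow> 'a set set \<Rightarrow> ('a set \<Rightarrow> real) \<Rightarrow> 'a \<Rightarrow> 'a \<Rightarrow> real \<Rightarrow> bool" where
  "has_lly_curvature V E w x y \<kappa> \<longleftrightarrow>
     ((\<lambda>\<alpha>. alpha_curvature V E w \<alpha> x y / (1 - \<alpha>)) \<longlongrightarrow> \<kappa>) (at_left 1)"

definition discrete_einstein ::
  "'a set \<Rightarrow> 'a set set \<Rightarrow> ('a set \<Rightarrow> real) \<Rightarrow> real \<Rightarrow> bool" where
  "discrete_einstein V E w \<kappa> \<longleftrightarrow>
     (\<forall>e\<in>E. w e > 0) \<and> (\<forall>x y. {x, y} \<in> E \<longrightarrow> has_lly_curvature V E w x y \<kappa>)"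


section \<open>The Ricci matrix\<close>

text \<open>Distinct edges of a simple graph share at most one vertex, so the second sum is
  \<open>1 / degree E z\<close> if they meet in \<open>z\<close>, and \<open>0\<close> if they are disjoint.\<close>

definition ricci_matrix :: "'a set set \<Rightarrow> 'a set \<Rightarrow> 'a set \<Rightarrow> real" where
  "ricci_matrix E e e' =
     (if e = e' then - (\<Sum>x\<in>e. 1 / real (degree E x))
      else (\<Sum>z\<in>e \<inter> e'. 1 / real (degree E z)))"

definition ricci_eigenpair :: "'a set set \<Rightarrow> real \<Rightarrow> ('a set \<Rightarrow> real) \<Rightarrow> bool" where
  "ricci_eigenpair E \<mu> v \<longleftrightarrow>
     (\<exists>e\<in>E. v e \<noteq> 0) \<and> (\<forall>e\<in>E. (\<Sum>e'\<in>E. ricci_matrix E e e' * v e') = \<mu> * v e)"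

definition lambda_max :: "'a set set \<Rightarrow> real" where
  "lambda_max E = (GREATEST \<mu>. \<exists>v. ricci_eigenpair E \<mu> v)"

definition perron_eigenvector :: "'a set set \<Rightarrow> ('a set \<Rightarrow> real) \<Rightarrow> bool" where
  "perron_eigenvector E w \<longleftrightarrow> (\<forall>e\<in>E. w e > 0) \<and> ricci_eigenpair E (lambda_max E) w"


section \<open>Regular decorated cycles\<close>

text \<open>A cycle is given by the list of its vertices in cyclic order.\<close>

definition cycle_edge :: "'a list \<Rightarrow> nat \<Rightarrow> 'a set" where
  "cycle_edge c i = {c ! (i mod length c), c ! (Suc i mod length c)}"

definition cycle_edges :: "'a list \<Rightarrow> 'a set set" where
  "cycle_edges c = cycle_edge c ` {..<length c}"

definition is_cycle :: "'a set \<Rightarrow> 'a set set \<Rightarrow> 'a list \<Rightarrow> bool" where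
  "is_cycle V E c \<longleftrightarrow> 3 \<le> length c \<and> distinct c \<and> set c \<subseteq> V \<and> cycle_edges c \<subseteq> E"

text \<open>The pendant tree at a cycle vertex \<open>x\<close> is the component of \<open>x\<close> after deleting the
  cycle edges, with root \<open>x\<close>; it may consist of \<open>x\<close> alone.\<close>

definition pendant_vertices :: "'a set \<Rightarrow> 'a set set \<Rightarrow> 'a list \<Rightarrow> 'a \<Rightarrow> 'a set" where
  "pendant_vertices V E c x = {v. \<exists>p. is_path V (E - cycle_edges c) x v p}"

definition pendant_edges :: "'a set \<Rightarrow> 'a set set \<Rightarrow> 'a list \<Rightarrow> 'a \<Rightarrow> 'a set set" where
  "pendant_edges V E c x = {e \<in> E - cycle_edges c. e \<subseteq> pendant_vertices V E c x}"

definition rooted_isomorphic ::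
  "'a set \<Rightarrow> 'a set set \<Rightarrow> 'a \<Rightarrow> 'a set \<Rightarrow> 'a set set \<Rightarrow> 'a \<Rightarrow> bool" where
  "rooted_isomorphic V1 E1 r1 V2 E2 r2 \<longleftrightarrow>
     (\<exists>f. bij_betw f V1 V2 \<and> f r1 = r2 \<and>
        (\<forall>u\<in>V1. \<forall>v\<in>V1. {u, v} \<in> E1 \<longleftrightarrow> {f u, f v} \<in> E2))"

definition regular_decorated_cycle ::
  "'a set \<Rightarrow> 'a set set \<Rightarrow> 'a list \<Rightarrow> nat \<Rightarrow> nat \<Rightarrow> bool" where
  "regular_decorated_cycle V E c g d \<longleftrightarrow>
     unicyclic V E \<and> is_cycle V E c \<and> length c = g \<and>
     (\<forall>x\<in>set c. degree E x = d) \<and>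
     (\<forall>x\<in>set c. \<forall>y\<in>set c.
        rooted_isomorphic
          (pendant_vertices V E c x) (pendant_edges V E c x) x
          (pendant_vertices V E c y) (pendant_edges V E c y) y)"

definition three_edge_condition :: "('a set \<Rightarrow> real) \<Rightarrow> 'a list \<Rightarrow> bool" where
  "three_edge_condition w c \<longleftrightarrow>
     (\<forall>i<length c. w (cycle_edge c i) + w (cycle_edge c (i + 1)) + w (cycle_edge c (i + 2))
        \<le> (\<Sum>e\<in>cycle_edges c. w e) / 2)"

end

theory Submission imports Defs begin

text \<open>The Perron vector exists as a maximizer of the Rayleigh quotient and is unique up to
  scaling. Gluing the isomorphisms of the pendant trees gives an automorphism that rotates the
  cycle; it fixes the Perron vector, which is therefore constant on the cycle.

  Let \<open>w\<close> be positive and constant on the cycle. For an edge \<open>{x, y}\<close> and idleness near 1, an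
  optimal plan sends all excess mass through the edge. It is certified by a 1-Lipschitz function
  that descends with maximal slope along all paths \<open>z, x, y, z'\<close>. On a bridge such a function
  always exists; on a cycle edge it exists because at least three cycle edges remain besides
  \<open>{x, y}\<close> and its two neighbours. The transport cost is then affine in 1 minus the idleness, and
  its slope is the \<open>{x, y}\<close> entry of the Ricci matrix applied to \<open>w\<close>.\<close>

section \<open>Reachability along edges\<close>

text \<open>The shape of the graph enters through one count: a connected graph has at least
  \<open>card V - 1\<close> edges, so with \<open>card E = card V\<close> no two edges can both be
  bypassed. This obstruction makes every non-cycle edge a bridge and keeps the pendant trees at
  different cycle vertices disjoint.

  Masses are never matched explicitly. For idleness above 1/2 the excess can only sit at
  \<open>x\<close> and its neighbours other than \<open>y\<close>, the deficit only at
  \<open>y\<close> and its neighbours other than \<open>x\<close>, and the potential is tight on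
  every such pair. Any plan that leaves the overlap in place is then optimal, even the one that
  couples the remainders independently.

  The Ricci matrix has a negative diagonal, so Perron theory for nonnegative matrices does not apply
  to it directly. The Rayleigh quotient only needs the off-diagonal signs: passing from
  \<open>v\<close> to its absolute values leaves the diagonal terms unchanged.\<close>

abbreviation linked :: "'a set set \<Rightarrow> 'a \<Rightarrow> 'a \<Rightarrow> bool" where
  "linked F \<equiv> (\<lambda>u v. {u, v} \<in> F)\<^sup>*\<^sup>*"

lemma linked_edge: "{a, b} \<in> F \<Longrightarrow> linked F a b"
  by (rule r_into_rtranclp)

lemma linked_sym: "linked F a b \<Longrightarrow> linked F b a"
proof (induction rule: rtranclp_induct)
  case (step y z)
  then show ?case
    by (metis (mono_tags, lifting) converse_rtranclp_into_rtranclp insert_commute)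
qed simp

lemma linked_subst:
  assumes "linked F x y" and "\<And>a b. {a, b} \<in> F \<Longrightarrow> linked G a b"
  shows "linked G x y"
  using assms(1) by (induction rule: rtranclp_induct) (auto intro: rtranclp_trans assms(2))

lemma linked_crossing_edge:
  assumes "linked F a b" "a \<in> U" "b \<notin> U"
  obtains u v where "u \<in> U" "v \<notin> U" "{u, v} \<in> F"
  using assms by (induction rule: rtranclp_induct) blast+

lemma linked_insert_cases:
  assumes "linked F x y" and "\<And>a b. {a, b} \<in> F - {e} \<Longrightarrow> linked G a b"
    and "e = {p, q}" and "linked G p q"
  shows "linked G x y"
proof (rule linked_subst[OF assms(1)])
  fix a b assume "{a, b} \<in> F"
  then show "linked G a b"
    using assms(2-4) linked_sym[OF assms(4)] by (cases "{a, b} = e") (auto simp: doubleton_eq_iff)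
qed

lemma is_path_linked: "is_path V F x y p \<Longrightarrow> linked F x y"
proof (induction p arbitrary: x)
  case (Cons a p)
  show ?case
  proof (cases p)
    case Nil
    with Cons.prems have "x = y" by (auto simp: is_path_def)
    then show ?thesis by blast
  next
    case (Cons b q)
    then have "is_path V F b y p" "{x, b} \<in> F"
      using Cons.prems by (auto simp: is_path_def)
    then show ?thesis
      using Cons.IH by (meson converse_rtranclp_into_rtranclp)
  qed
qed (simp add: is_path_def)

text \<open>Paths must have distinct vertices, so a walk that returns to a vertex of the path built
  so far is cut back to that vertex instead of being extended.\<close>

lemma linked_is_path:
  assumes "linked F x y" "x \<in> V" "\<And>e. e \<in> F \<Longrightarrow> e \<subseteq> V"
  shows "\<exists>p. is_path V F x y p"
  using assms(1)
proof (induction rule: rtranclp_induct)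
  case base
  have "is_path V F x x [x]" using assms(2) by (simp add: is_path_def)
  then show ?case ..
next
  case (step y z)
  then obtain p where p: "is_path V F x y p" by blast
  have "z \<in> V" using step(2) assms(3) by blast
  show ?case
  proof (cases "z \<in> set p")
    case True
    then obtain q r where "p = q @ z # r" by (meson split_list)
    then have "is_path V F x z (q @ [z])"
      using p by (cases q) (auto simp: is_path_def successively_append_iff successively_Cons hd_append)
    then show ?thesis ..
  next
    case False
    then have "is_path V F x z (p @ [z])"
      using p \<open>z \<in> V\<close> step(2) by (auto simp: is_path_def successively_append_iff)
    then show ?thesis ..
  qed
qed

lemma connected_graph_linked:
  assumes "connected_graph V E" "u \<in> V" "v \<in> V"
  shows "linked E u v"
proof -
  obtain p where "is_path V E u v p" using assms unfolding connected_graph_def by blast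
  then show ?thesis by (rule is_path_linked)
qed

text \<open>Take a maximal vertex set containing \<open>r\<close> that spans at least as many edges
  as it has vertices, less one. If it missed a vertex, a crossing edge would add one vertex and at
  least one spanned edge, against maximality.\<close>

lemma connected_card_le:
  assumes fin: "finite V" "finite E" and sub: "\<And>e. e \<in> E \<Longrightarrow> e \<subseteq> V"
    and r: "r \<in> V" and conn: "\<And>v. v \<in> V \<Longrightarrow> linked E r v"
  shows "card V \<le> card E + 1"
proof -
  define \<U> where "\<U> = {U. U \<subseteq> V \<and> r \<in> U \<and> card U \<le> card {e \<in> E. e \<subseteq> U} + 1}"
  have "finite \<U>" using fin(1) by (auto simp: \<U>_def)
  moreover have "{r} \<in> \<U>" using r by (simp add: \<U>_def)
  ultimately obtain U where U: "U \<in> \<U>" and max: "\<And>W. W \<in> \<U> \<Longrightarrow> U \<subseteq> W \<Longrightarrow> U = W"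
    using finite_has_maximal[of \<U>] by (metis empty_iff)
  have "V \<subseteq> U"
  proof
    fix v assume "v \<in> V"
    show "v \<in> U"
    proof (rule ccontr)
      assume "v \<notin> U"
      moreover have "r \<in> U" using U by (simp add: \<U>_def)
      ultimately obtain a b where ab: "a \<in> U" "b \<notin> U" "{a, b} \<in> E"
        using linked_crossing_edge[OF conn[OF \<open>v \<in> V\<close>]] by metis
      then have b: "b \<in> V" using sub by blast
      have finU: "finite U" using U fin(1) finite_subset by (auto simp: \<U>_def)
      have "card {e \<in> E. e \<subseteq> U} + 1 = card (insert {a, b} {e \<in> E. e \<subseteq> U})"
        using ab(2) fin(2) by simp
      also have "\<dots> \<le> card {e \<in> E. e \<subseteq> insert b U}"
        using ab fin(2) by (intro card_mono) auto
      finally have "insert b U \<in> \<U>"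
        using U b ab(2) finU by (auto simp: \<U>_def)
      then show False using max ab(2) by blast
    qed
  qed
  then have "U = V" using U by (auto simp: \<U>_def)
  moreover have "card {e \<in> E. e \<subseteq> U} \<le> card E" by (intro card_mono fin(2)) auto
  ultimately show ?thesis using U by (simp add: \<U>_def)
qed

section \<open>Perron eigenvectors of symmetric matrices\<close>

text \<open>Near 0 the linear term dominates the quadratic one. This replaces differentiation in the
  first-order condition for the Rayleigh quotient; the chosen \<open>s\<close> is small enough for
  the linear term to win whatever the sign of \<open>q\<close>.\<close>

lemma linear_coeff_zero:
  fixes p q :: real
  assumes "\<And>s. s * p + s\<^sup>2 * q \<le> 0"
  shows "p = 0"
proof (rule ccontr)
  assume "p \<noteq> 0"
  define s where "s = p / (\<bar>q\<bar> + 1)"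
  have "s * p + s\<^sup>2 * q = p\<^sup>2 * (\<bar>q\<bar> + 1 + q) / (\<bar>q\<bar> + 1)\<^sup>2"
    by (simp add: s_def power2_eq_square divide_simps) (simp add: algebra_simps)
  moreover have "\<dots> > 0" using \<open>p \<noteq> 0\<close> by (intro divide_pos_pos mult_pos_pos) auto
  ultimately show False using assms[of s] by linarith
qed

text \<open>Stated by cuts rather than by powers of the matrix: a positive entry across a cut is
  what the argument on zero sets consumes and what connectivity of a graph supplies.\<close>

definition irreducible_on :: "'i set \<Rightarrow> ('i \<Rightarrow> 'i \<Rightarrow> real) \<Rightarrow> bool" where
  "irreducible_on I A \<longleftrightarrow>
     (\<forall>S\<subseteq>I. S \<noteq> {} \<longrightarrow> S \<noteq> I \<longrightarrow> (\<exists>i\<in>S. \<exists>j\<in>I - S. A i j > 0))"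

locale irreducible_symmetric =
  fixes I :: "'i set" and A :: "'i \<Rightarrow> 'i \<Rightarrow> real"
  assumes finite_I: "finite I" and I_nonempty: "I \<noteq> {}"
    and sym: "\<And>i j. A i j = A j i"
    and offdiag_nonneg: "\<And>i j. i \<noteq> j \<Longrightarrow> A i j \<ge> 0"
    and irreducible: "irreducible_on I A"
begin

abbreviation eigen :: "real \<Rightarrow> ('i \<Rightarrow> real) \<Rightarrow> bool" where
  "eigen \<mu> v \<equiv> \<forall>i\<in>I. (\<Sum>j\<in>I. A i j * v j) = \<mu> * v i"

definition quad :: "('i \<Rightarrow> real) \<Rightarrow> real" where
  "quad v = (\<Sum>i\<in>I. \<Sum>j\<in>I. A i j * v i * v j)"

lemma quad_alt: "quad v = (\<Sum>i\<in>I. v i * (\<Sum>j\<in>I. A i j * v j))"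
  by (simp add: quad_def sum_distrib_left algebra_simps)

lemma quad_eigen: "eigen \<mu> v \<Longrightarrow> quad v = \<mu> * (\<Sum>i\<in>I. (v i)\<^sup>2)"
  by (simp add: quad_alt sum_distrib_left power2_eq_square algebra_simps)

text \<open>At an index where \<open>v\<close> vanishes the eigenvalue equation says that a sum of
  nonnegative terms is 0. So no positive entry leads from the zero set to its complement, which
  contradicts irreducibility.\<close>

lemma nonneg_eigenvector_pos:
  assumes "eigen \<mu> v" "\<And>i. i \<in> I \<Longrightarrow> v i \<ge> 0" "k \<in> I" "v k \<noteq> 0"
  shows "\<forall>i\<in>I. v i > 0"
proof (rule ccontr)
  assume not_pos: "\<not> (\<forall>i\<in>I. v i > 0)"
  define S where "S = {i \<in> I. v i = 0}"
  have "S \<subseteq> I" "S \<noteq> {}" "S \<noteq> I"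
    using not_pos assms(2-4) by (auto simp: S_def not_less intro: antisym)
  then obtain i j where ij: "i \<in> S" "j \<in> I - S" "A i j > 0"
    using irreducible unfolding irreducible_on_def by blast
  have "A i l * v l \<ge> 0" if "l \<in> I" for l
    using offdiag_nonneg[of i l] assms(2)[OF that] ij(1) by (cases "l = i") (auto simp: S_def)
  moreover have "(\<Sum>l\<in>I. A i l * v l) = 0" using assms(1) ij(1) by (auto simp: S_def)
  ultimately have "A i j * v j = 0"
    using sum_nonneg_eq_0_iff[OF finite_I, of "\<lambda>l. A i l * v l"] ij(2) by auto
  then show False using ij by (auto simp: S_def)
qed

text \<open>A continuous function attains its supremum on the compact unit sphere; homogeneity of
  degree 2 extends the bound to all \<open>u\<close>.\<close>

lemma exists_quad_maximizer:
  obtains v where "(\<Sum>i\<in>I. (v i)\<^sup>2) = 1" "\<And>u. quad u \<le> quad v * (\<Sum>i\<in>I. (u i)\<^sup>2)"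
proof -
  \<comment> \<open>The topology is that of all functions on the index type. Pinning the coordinates
    outside \<open>I\<close> to 0 makes \<open>B\<close> a product of compact sets.\<close>
  define B where "B = Pi\<^sub>E UNIV (\<lambda>i. if i \<in> I then {-1..1::real} else {0})"
  define K where "K = B \<inter> {v. (\<Sum>i\<in>I. (v i)\<^sup>2) = 1}"
  have "compactin (product_topology (\<lambda>_::'i. euclidean) UNIV) B"
    unfolding B_def by (subst compactin_PiE) auto
  then have "compact B"
    by (metis compactin_euclidean_iff euclidean_product_topology)
  moreover have "closed {v :: 'i \<Rightarrow> real. (\<Sum>i\<in>I. (v i)\<^sup>2) = 1}"
    by (intro closed_Collect_eq continuous_intros continuous_on_product_coordinates)
  ultimately have "compact K" unfolding K_def by (rule compact_Int_closed)
  moreover have "continuous_on K quad"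
    unfolding quad_def
    by (intro continuous_intros continuous_on_subset[OF continuous_on_product_coordinates]) auto
  moreover obtain k where k: "k \<in> I" using I_nonempty by blast
  have "(\<lambda>i. if i = k then 1 else 0) \<in> K"
    using k finite_I by (auto simp: K_def B_def if_distrib[of "\<lambda>x. x\<^sup>2"] cong: if_cong)
  then have "K \<noteq> {}" by blast
  ultimately obtain v where v: "v \<in> K" "\<And>u. u \<in> K \<Longrightarrow> quad u \<le> quad v"
    using continuous_attains_sup by metis
  show ?thesis
  proof (rule that)
    show "(\<Sum>i\<in>I. (v i)\<^sup>2) = 1" using v(1) by (simp add: K_def)
    fix u :: "'i \<Rightarrow> real"
    define n where "n = (\<Sum>i\<in>I. (u i)\<^sup>2)"
    show "quad u \<le> quad v * n"
    proof (cases "n = 0")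
      case True
      then have "\<forall>i\<in>I. u i = 0"
        using finite_I by (simp add: n_def sum_nonneg_eq_0_iff)
      then show ?thesis using True by (simp add: quad_def)
    next
      case False
      then have n: "n > 0" by (metis n_def less_eq_real_def sum_nonneg zero_le_power2)
      define u' where "u' = (\<lambda>i. if i \<in> I then u i / sqrt n else 0)"
      have sq: "(u' i)\<^sup>2 = (u i)\<^sup>2 / n" if "i \<in> I" for i
        using n that by (simp add: u'_def power_divide)
      have "(\<Sum>i\<in>I. (u' i)\<^sup>2) = (\<Sum>i\<in>I. (u i)\<^sup>2 / n)"
        by (simp add: sq)
      also have "\<dots> = n / n"
        unfolding n_def by (rule sum_divide_distrib[symmetric])
      finally have one: "(\<Sum>i\<in>I. (u' i)\<^sup>2) = 1" using n by simp
      have "\<bar>u' i\<bar> \<le> 1" if "i \<in> I" for i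
      proof -
        have "(u' i)\<^sup>2 \<le> 1"
          unfolding one[symmetric] using that finite_I by (intro member_le_sum) auto
        then show ?thesis by (simp add: abs_square_le_1)
      qed
      then have "u' \<in> K"
        using one by (auto simp: K_def B_def abs_le_iff) (auto simp: u'_def)
      then have "quad u' \<le> quad v" by (rule v(2))
      moreover have "quad u' = quad u / n"
      proof -
        have "A i j * u' i * u' j = A i j * u i * u j / n" if "i \<in> I" "j \<in> I" for i j
          using that n by (simp add: u'_def)
        then show ?thesis by (simp add: quad_def sum_divide_distrib)
      qed
      ultimately show ?thesis using n by (simp add: field_simps)
    qed
  qed
qed

lemma quad_perturb:
  assumes k: "k \<in> I"
  shows "quad (\<lambda>i. v i + (if i = k then s else 0)) =
    quad v + 2 * s * (\<Sum>j\<in>I. A k j * v j) + s\<^sup>2 * A k k"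
proof -
  let ?d = "\<lambda>i. if i = k then s else 0"
  have "quad (\<lambda>i. v i + ?d i) =
      (\<Sum>i\<in>I. \<Sum>j\<in>I. A i j * v i * v j) + (\<Sum>i\<in>I. \<Sum>j\<in>I. A i j * v i * ?d j) +
      (\<Sum>i\<in>I. \<Sum>j\<in>I. A i j * ?d i * v j) + (\<Sum>i\<in>I. \<Sum>j\<in>I. A i j * ?d i * ?d j)"
    unfolding quad_def sum.distrib[symmetric]
    by (intro sum.cong refl) (simp only: algebra_simps)
  also have "(\<Sum>i\<in>I. \<Sum>j\<in>I. A i j * v i * ?d j) = s * (\<Sum>j\<in>I. A k j * v j)"
    using k finite_I by (simp add: if_distrib[of "\<lambda>x. _ * x"] sum_distrib_left sym[of _ k] mult_ac cong: if_cong)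
  also have "(\<Sum>i\<in>I. \<Sum>j\<in>I. A i j * ?d i * v j) = s * (\<Sum>j\<in>I. A k j * v j)"
  proof -
    have "(\<Sum>i\<in>I. \<Sum>j\<in>I. A i j * ?d i * v j) = (\<Sum>i\<in>I. if i = k then s * (\<Sum>j\<in>I. A k j * v j) else 0)"
      by (intro sum.cong refl) (simp add: sum_distrib_left mult_ac)
    then show ?thesis using k finite_I by simp
  qed
  also have "(\<Sum>i\<in>I. \<Sum>j\<in>I. A i j * ?d i * ?d j) = s\<^sup>2 * A k k"
  proof -
    have "(\<Sum>i\<in>I. \<Sum>j\<in>I. A i j * ?d i * ?d j) = (\<Sum>i\<in>I. \<Sum>j\<in>I. if j = k then (if i = k then s\<^sup>2 * A k k else 0) else 0)"
      by (intro sum.cong refl) (simp add: power2_eq_square)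
    then show ?thesis using k finite_I by simp
  qed
  finally show ?thesis by (simp add: quad_def)
qed

text \<open>Stationarity, one coordinate at a time: change \<open>v\<close> by \<open>s\<close> at
  \<open>k\<close> and compare with the maximum. The coefficient of \<open>s\<close> in the
  resulting inequality is \<open>p\<close>, and it must vanish.\<close>

lemma quad_maximizer_eigen:
  assumes one: "(\<Sum>i\<in>I. (v i)\<^sup>2) = 1" and max: "\<And>u. quad u \<le> quad v * (\<Sum>i\<in>I. (u i)\<^sup>2)"
  shows "eigen (quad v) v"
proof
  fix k assume k: "k \<in> I"
  define p where "p = 2 * ((\<Sum>j\<in>I. A k j * v j) - quad v * v k)"
  have "s * p + s\<^sup>2 * (A k k - quad v) \<le> 0" for s
  proof -
    let ?u = "\<lambda>i. v i + (if i = k then s else 0)"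
    have "(\<Sum>i\<in>I. (?u i)\<^sup>2) = (\<Sum>i\<in>I. (v i)\<^sup>2 + (if i = k then 2 * s * v k + s\<^sup>2 else 0))"
      by (intro sum.cong refl) (simp add: power2_eq_square algebra_simps)
    also have "\<dots> = 1 + 2 * s * v k + s\<^sup>2"
      using k finite_I one by (simp add: sum.distrib)
    finally have "quad ?u \<le> quad v * (1 + 2 * s * v k + s\<^sup>2)" using max[of ?u] by simp
    then show ?thesis unfolding quad_perturb[OF k] p_def by (simp add: algebra_simps)
  qed
  then have "p = 0" by (rule linear_coeff_zero)
  then show "(\<Sum>j\<in>I. A k j * v j) = quad v * v k" by (simp add: p_def)
qed

text \<open>Taking absolute values keeps the norm and cannot lower \<open>quad\<close>, so a
  maximizer may be taken nonnegative, and then it is positive. Every eigenvalue is the Rayleigh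
  quotient of its eigenvector, hence bounded by the maximum.\<close>

lemma perron_exists:
  obtains \<mu> w where "\<forall>i\<in>I. w i > 0" "eigen \<mu> w"
    "\<And>\<nu> v. eigen \<nu> v \<Longrightarrow> \<exists>i\<in>I. v i \<noteq> 0 \<Longrightarrow> \<nu> \<le> \<mu>"
proof -
  obtain v where one: "(\<Sum>i\<in>I. (v i)\<^sup>2) = 1" and max: "\<And>u. quad u \<le> quad v * (\<Sum>i\<in>I. (u i)\<^sup>2)"
    using exists_quad_maximizer by metis
  define w where "w = (\<lambda>i. \<bar>v i\<bar>)"
  have w1: "(\<Sum>i\<in>I. (w i)\<^sup>2) = 1" using one by (simp add: w_def)
  have "quad v \<le> quad w" unfolding quad_def
  proof (intro sum_mono)
    fix i j
    show "A i j * v i * v j \<le> A i j * w i * w j"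
    proof (cases "i = j")
      case False
      have "A i j * (v i * v j) \<le> A i j * \<bar>v i * v j\<bar>"
        using offdiag_nonneg[OF False] by (intro mult_left_mono) auto
      then show ?thesis by (simp add: w_def abs_mult mult.assoc)
    qed (simp add: w_def mult.assoc)
  qed
  then have eq: "quad w = quad v" using max[of w] w1 by simp
  have eig: "eigen (quad w) w" using w1 max by (intro quad_maximizer_eigen) (auto simp: eq)
  have "\<exists>k\<in>I. w k \<noteq> 0"
  proof (rule ccontr)
    assume "\<not> ?thesis"
    then have "(\<Sum>i\<in>I. (w i)\<^sup>2) = 0" by simp
    with w1 show False by simp
  qed
  then have pos: "\<forall>i\<in>I. w i > 0"
    using nonneg_eigenvector_pos[OF eig] by (auto simp: w_def)
  show ?thesis
  proof (rule that[OF pos eig])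
    fix \<nu> u assume u: "eigen \<nu> u" "\<exists>i\<in>I. u i \<noteq> 0"
    have "\<nu> * (\<Sum>i\<in>I. (u i)\<^sup>2) \<le> quad w * (\<Sum>i\<in>I. (u i)\<^sup>2)"
      using max[of u] quad_eigen[OF u(1)] eq by simp
    moreover have "(\<Sum>i\<in>I. (u i)\<^sup>2) > 0"
      using u(2) finite_I by (metis sum_pos2 zero_le_power2 zero_less_power2)
    ultimately show "\<nu> \<le> quad w" by (simp add: mult_le_cancel_right)
  qed
qed

text \<open>Subtract from \<open>w'\<close> the largest multiple of \<open>w\<close> that stays
  below it. The difference is a nonnegative eigenvector with a zero at \<open>k\<close>, so it
  vanishes identically.\<close>

lemma pos_eigenvector_unique:
  assumes w: "\<forall>i\<in>I. w i > 0" "eigen \<mu> w" and w': "\<forall>i\<in>I. w' i > 0" "eigen \<mu> w'"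
  shows "\<exists>a>0. \<forall>i\<in>I. w' i = a * w i"
proof -
  define a where "a = Min ((\<lambda>i. w' i / w i) ` I)"
  have "a \<in> (\<lambda>i. w' i / w i) ` I"
    unfolding a_def using finite_I I_nonempty by (intro Min_in) auto
  then obtain k where k: "k \<in> I" "a = w' k / w k" by blast
  have le: "a * w i \<le> w' i" if "i \<in> I" for i
  proof -
    have "a \<le> w' i / w i" unfolding a_def using that finite_I by (intro Min_le) auto
    then show ?thesis using w(1) that by (simp add: pos_le_divide_eq)
  qed
  define u where "u = (\<lambda>i. w' i - a * w i)"
  have eig: "eigen \<mu> u"
  proof
    fix i assume "i \<in> I"
    have "(\<Sum>j\<in>I. A i j * u j) = (\<Sum>j\<in>I. A i j * w' j) - a * (\<Sum>j\<in>I. A i j * w j)"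
      by (simp add: u_def algebra_simps sum_subtractf sum_distrib_left)
    then show "(\<Sum>j\<in>I. A i j * u j) = \<mu> * u i"
      using w(2) w'(2) \<open>i \<in> I\<close> by (simp add: u_def algebra_simps)
  qed
  have "u k = 0" using k w(1) by (auto simp: u_def)
  then have "\<forall>i\<in>I. u i = 0"
    using nonneg_eigenvector_pos[OF eig] le k(1) by (fastforce simp: u_def)
  moreover have "a > 0" using k w(1) w'(1) by simp
  ultimately show ?thesis by (auto simp: u_def)
qed

end

section \<open>Wasserstein distance via potentials\<close>

text \<open>The common part \<open>a\<close> stays on the diagonal, and the remainders
  \<open>r\<close> and \<open>s\<close>, both of total mass \<open>p\<close>, are coupled
  independently with density \<open>r u * s v / p\<close>. A remainder is nonzero only where its own
  measure is strictly larger.\<close>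

lemma exists_overlap_coupling:
  fixes \<mu> \<nu> :: "'a pmf"
  assumes fin: "finite (set_pmf \<mu>)" "finite (set_pmf \<nu>)"
  obtains \<pi> where "map_pmf fst \<pi> = \<mu>" "map_pmf snd \<pi> = \<nu>"
    "\<forall>u v. (u, v) \<in> set_pmf \<pi> \<longrightarrow> u = v \<or> (pmf \<mu> u > pmf \<nu> u \<and> pmf \<nu> v > pmf \<mu> v)"
proof -
  define S where "S = set_pmf \<mu> \<union> set_pmf \<nu>"
  have S: "finite S" using fin by (simp add: S_def)
  define a where "a = (\<lambda>u. min (pmf \<mu> u) (pmf \<nu> u))"
  define r where "r = (\<lambda>u. pmf \<mu> u - a u)"
  define s where "s = (\<lambda>u. pmf \<nu> u - a u)"
  define p where "p = 1 - sum a S"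
  have nonneg: "a u \<ge> 0" "r u \<ge> 0" "s u \<ge> 0" for u by (auto simp: a_def r_def s_def)
  have outside: "a u = 0" "r u = 0" "s u = 0" if "u \<notin> S" for u
    using that by (auto simp: a_def r_def s_def S_def set_pmf_iff)
  have sums: "sum (pmf \<mu>) S = 1" "sum (pmf \<nu>) S = 1"
    using S by (auto intro!: sum_pmf_eq_1 simp: S_def)
  then have rs: "sum r S = p" "sum s S = p" by (simp_all add: r_def s_def p_def sum_subtractf)
  have p: "p \<ge> 0" unfolding rs(1)[symmetric] by (intro sum_nonneg nonneg)
  \<comment> \<open>For \<open>p = 0\<close> the quotient is 0 by convention, but both remainders
    vanish as well, so the marginal computations need no separate case.\<close>
  have scale: "r u * p / p = r u" "s u * p / p = s u" for u
  proof -
    have "r u = 0 \<and> s u = 0" if "p = 0"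
    proof (cases "u \<in> S")
      case True
      have "sum r S = 0" "sum s S = 0" using rs that by auto
      then show ?thesis using True S nonneg by (simp add: sum_nonneg_eq_0_iff)
    qed (simp add: outside)
    then show "r u * p / p = r u" "s u * p / p = s u" by auto
  qed
  define q where "q = (\<lambda>(u, v). (if u = v then a u else 0) + r u * s v / p)"
  have q_nonneg: "q x \<ge> 0" for x using nonneg p by (auto simp: q_def split: prod.split)
  have q_out: "q x = 0" if "x \<notin> S \<times> S" for x
  proof -
    obtain u v where x: "x = (u, v)" by (cases x)
    then have "u \<notin> S \<or> v \<notin> S" using that by auto
    then show ?thesis using outside[of u] outside[of v] unfolding x q_def by auto
  qed
  have row: "(\<Sum>v\<in>S. q (u, v)) = pmf \<mu> u" if "u \<in> S" for u
  proof -
    have "(\<Sum>v\<in>S. q (u, v)) = a u + (\<Sum>v\<in>S. r u * s v / p)"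
      using that S by (simp add: q_def sum.distrib)
    also have "(\<Sum>v\<in>S. r u * s v / p) = r u * p / p"
      by (simp add: rs(2)[symmetric] sum_distrib_left sum_divide_distrib)
    finally show ?thesis by (simp only: scale) (simp add: r_def)
  qed
  have col: "(\<Sum>u\<in>S. q (u, v)) = pmf \<nu> v" if "v \<in> S" for v
  proof -
    have "(\<Sum>u\<in>S. q (u, v)) = a v + (\<Sum>u\<in>S. r u * s v / p)"
      using that S by (simp add: q_def sum.distrib)
    also have "(\<Sum>u\<in>S. r u * s v / p) = s v * p / p"
      by (simp add: rs(1)[symmetric] sum_distrib_left sum_distrib_right sum_divide_distrib mult_ac)
    finally show ?thesis by (simp only: scale) (simp add: s_def)
  qed
  have total: "sum q (S \<times> S) = 1"
  proof -
    have "sum q (S \<times> S) = (\<Sum>u\<in>S. \<Sum>v\<in>S. q (u, v))" by (simp add: sum.cartesian_product)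
    also have "\<dots> = 1" using row sums(1) by simp
    finally show ?thesis .
  qed
  have "(\<integral>\<^sup>+x. ennreal (q x) \<partial>count_space UNIV) = (\<Sum>x\<in>S \<times> S. ennreal (q x))"
    using S q_out by (intro nn_integral_count_space') auto
  also have "\<dots> = 1" using q_nonneg total by (simp add: sum_ennreal)
  finally have mass: "(\<integral>\<^sup>+x. ennreal (q x) \<partial>count_space UNIV) = 1" .
  define \<pi> where "\<pi> = embed_pmf q"
  have pmf_\<pi>: "pmf \<pi> x = q x" for x
    unfolding \<pi>_def using q_nonneg mass by (intro pmf_embed_pmf)
  have set_\<pi>: "set_pmf \<pi> \<subseteq> S \<times> S" 
  proof
    fix x assume "x \<in> set_pmf \<pi>"
    then have "q x \<noteq> 0" by (simp add: set_pmf_iff pmf_\<pi>)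
    then show "x \<in> S \<times> S" using q_out[of x] by blast
  qed
  have marg: "pmf (map_pmf f \<pi>) u = (\<Sum>x\<in>{x \<in> S \<times> S. f x = u}. q x)" for f u
  proof -
    have "pmf (map_pmf f \<pi>) u = measure \<pi> (f -` {u})" by (rule pmf_map)
    also have "\<dots> = measure \<pi> {x \<in> S \<times> S. f x = u}"
      using set_\<pi> by (intro measure_pmf.finite_measure_eq_AE) (auto simp: AE_measure_pmf_iff)
    also have "\<dots> = (\<Sum>x\<in>{x \<in> S \<times> S. f x = u}. q x)"
      using S by (subst measure_measure_pmf_finite) (auto simp: pmf_\<pi>)
    finally show ?thesis .
  qed
  show ?thesis
  proof (rule that)
    show "map_pmf fst \<pi> = \<mu>"
    proof (rule pmf_eqI)
      fix u
      show "pmf (map_pmf fst \<pi>) u = pmf \<mu> u"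
      proof (cases "u \<in> S")
        case True
        then have "{x \<in> S \<times> S. fst x = u} = Pair u ` S" by auto
        then show ?thesis using row[OF True] by (simp add: marg sum.reindex inj_on_def)
      next
        case False
        then have empty: "{x \<in> S \<times> S. fst x = u} = {}" by auto
        show ?thesis unfolding marg empty using False by (simp add: S_def set_pmf_iff)
      qed
    qed
    show "map_pmf snd \<pi> = \<nu>"
    proof (rule pmf_eqI)
      fix u
      show "pmf (map_pmf snd \<pi>) u = pmf \<nu> u"
      proof (cases "u \<in> S")
        case True
        then have "{x \<in> S \<times> S. snd x = u} = (\<lambda>v. (v, u)) ` S" by auto
        then show ?thesis using col[OF True] by (simp add: marg sum.reindex inj_on_def)
      next
        case False
        then have empty: "{x \<in> S \<times> S. snd x = u} = {}" by auto
        show ?thesis unfolding marg empty using False by (simp add: S_def set_pmf_iff)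
      qed
    qed
    have "u = v \<or> (pmf \<mu> u > pmf \<nu> u \<and> pmf \<nu> v > pmf \<mu> v)" if "(u, v) \<in> set_pmf \<pi>" for u v
    proof -
      have "q (u, v) \<noteq> 0" using that by (simp add: set_pmf_iff pmf_\<pi>)
      then have "u = v \<or> (r u \<noteq> 0 \<and> s v \<noteq> 0)" by (auto simp: q_def split: if_splits)
      then show ?thesis by (auto simp: r_def s_def a_def min_def split: if_splits)
    qed
    then show "\<forall>u v. (u, v) \<in> set_pmf \<pi> \<longrightarrow> u = v \<or> (pmf \<mu> u > pmf \<nu> u \<and> pmf \<nu> v > pmf \<mu> v)"
      by blast
  qed
qed

text \<open>Kantorovich duality in the easy direction: the coupling that keeps the overlap of both
  measures in place is optimal as soon as the remaining mass only moves along tight pairs.\<close>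

lemma wasserstein_eq_potential:
  assumes fin: "finite (set_pmf \<mu>)" "finite (set_pmf \<nu>)"
    and lip: "\<And>u v. u \<in> set_pmf \<mu> \<Longrightarrow> v \<in> set_pmf \<nu> \<Longrightarrow> f u - f v \<le> \<delta> u v"
    and diag: "\<And>u. u \<in> set_pmf \<mu> \<Longrightarrow> \<delta> u u = 0"
    and tight: "\<And>u v. pmf \<mu> u > pmf \<nu> u \<Longrightarrow> pmf \<nu> v > pmf \<mu> v \<Longrightarrow> \<delta> u v = f u - f v"
  shows "wasserstein \<delta> \<mu> \<nu> =
    measure_pmf.expectation \<mu> f - measure_pmf.expectation \<nu> f"
proof -
  define C where "C = {\<pi>. map_pmf fst \<pi> = \<mu> \<and> map_pmf snd \<pi> = \<nu>}"
  let ?gap = "measure_pmf.expectation \<mu> f - measure_pmf.expectation \<nu> f"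
  have supp: "u \<in> set_pmf \<mu>" "v \<in> set_pmf \<nu>" if "\<pi> \<in> C" "(u, v) \<in> set_pmf \<pi>" for \<pi> u v
    using that unfolding C_def by force+
  have int: "integrable \<pi> h" if "\<pi> \<in> C" for \<pi> and h :: "'a \<times> 'a \<Rightarrow> real"
  proof (rule integrable_measure_pmf_finite)
    have "set_pmf \<pi> \<subseteq> set_pmf \<mu> \<times> set_pmf \<nu>" using supp[OF that] by auto
    then show "finite (set_pmf \<pi>)" by (rule finite_subset) (simp add: fin)
  qed
  \<comment> \<open>By linearity this integral depends on the marginals alone, so it is the same for
    all couplings.\<close>
  have gap: "measure_pmf.expectation \<pi> (\<lambda>(u, v). f u - f v) = ?gap" if "\<pi> \<in> C" for \<pi>
  proof -
    have "\<mu> = map_pmf fst \<pi>" "\<nu> = map_pmf snd \<pi>" using that by (auto simp: C_def)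
    then have "?gap = measure_pmf.expectation \<pi> (\<lambda>x. f (fst x)) - measure_pmf.expectation \<pi> (\<lambda>x. f (snd x))"
      by simp
    also have "\<dots> = measure_pmf.expectation \<pi> (\<lambda>x. f (fst x) - f (snd x))"
      by (rule Bochner_Integration.integral_diff[symmetric]) (rule int[OF that])+
    finally show ?thesis by (simp add: case_prod_unfold)
  qed
  have lower: "?gap \<le> measure_pmf.expectation \<pi> (\<lambda>(u, v). \<delta> u v)" if "\<pi> \<in> C" for \<pi>
    unfolding gap[OF that, symmetric]
    by (intro integral_mono_AE int[OF that]) (auto simp: AE_measure_pmf_iff intro: lip supp[OF that])
  obtain \<pi> where marginals: "map_pmf fst \<pi> = \<mu>" "map_pmf snd \<pi> = \<nu>"
    and opt: "\<forall>u v. (u, v) \<in> set_pmf \<pi> \<longrightarrow> u = v \<or> (pmf \<mu> u > pmf \<nu> u \<and> pmf \<nu> v > pmf \<mu> v)"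
    by (rule exists_overlap_coupling[OF fin])
  then have \<pi>: "\<pi> \<in> C" by (simp add: C_def)
  have gap_eq: "\<delta> u v = f u - f v" if "(u, v) \<in> set_pmf \<pi>" for u v
    using opt[rule_format, OF that]
  proof
    assume "u = v"
    then show ?thesis using diag[OF supp(1)[OF \<pi> that]] by simp
  next
    assume "pmf \<nu> u < pmf \<mu> u \<and> pmf \<mu> v < pmf \<nu> v"
    then show ?thesis by (intro tight) auto
  qed
  have "measure_pmf.expectation \<pi> (\<lambda>(u, v). \<delta> u v) = measure_pmf.expectation \<pi> (\<lambda>(u, v). f u - f v)"
  proof (intro integral_cong_AE)
    show "AE x in measure_pmf \<pi>. (case x of (u, v) \<Rightarrow> \<delta> u v) = (case x of (u, v) \<Rightarrow> f u - f v)"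
      unfolding AE_measure_pmf_iff using gap_eq by auto
  qed auto
  then have attained: "measure_pmf.expectation \<pi> (\<lambda>(u, v). \<delta> u v) = ?gap" using gap[OF \<pi>] by simp
  have "wasserstein \<delta> \<mu> \<nu> = Inf ((\<lambda>\<pi>. measure_pmf.expectation \<pi> (\<lambda>(u, v). \<delta> u v)) ` C)"
    unfolding wasserstein_def C_def by (simp add: image_Collect)
  also have "\<dots> = ?gap"
    by (rule cInf_eq_minimum) (use attained \<pi> lower in \<open>auto intro!: image_eqI[of _ _ \<pi>]\<close>)
  finally show ?thesis .
qed

section \<open>Curvature of an edge from a potential\<close>

lemma simple_graph_neighbours:
  assumes "simple_graph V E"
  shows "finite (neighbours E x)" "x \<notin> neighbours E x" "neighbours E x \<subseteq> V"
proof -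
  show sub: "neighbours E x \<subseteq> V" using assms by (auto simp: simple_graph_def neighbours_def)
  then show "finite (neighbours E x)" using assms finite_subset by (auto simp: simple_graph_def)
  show "x \<notin> neighbours E x" using assms by (auto simp: simple_graph_def neighbours_def)
qed

lemma simple_graph_edge:
  assumes "simple_graph V E" "{x, y} \<in> E"
  shows "x \<noteq> y" "x \<in> V" "y \<in> V"
  using assms by (auto simp: simple_graph_def)

lemma simple_graph_edgeE:
  assumes "simple_graph V E" "e \<in> E"
  obtains x y where "e = {x, y}" "x \<noteq> y"
proof -
  have "card e = 2" using assms by (simp add: simple_graph_def)
  then show ?thesis using that by (auto simp: card_2_iff)
qed

lemma simple_graph_finite: "simple_graph V E \<Longrightarrow> finite E"
  by (rule finite_subset[of _ "Pow V"]) (auto simp: simple_graph_def)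

lemma incident_edges_eq:
  assumes "simple_graph V E"
  shows "{e \<in> E. z \<in> e} = (\<lambda>u. {z, u}) ` neighbours E z"
proof (intro equalityI subsetI)
  fix e assume e: "e \<in> {e \<in> E. z \<in> e}"
  then obtain a b where ab: "e = {a, b}" using simple_graph_edgeE[OF assms] by blast
  then have "e = {z, if z = a then b else a}" using e by auto
  then show "e \<in> (\<lambda>u. {z, u}) ` neighbours E z" using e by (auto simp: neighbours_def)
qed (auto simp: neighbours_def)

lemma incident_sum:
  assumes "simple_graph V E"
  shows "(\<Sum>e | e \<in> E \<and> z \<in> e. h e) = (\<Sum>u\<in>neighbours E z. h {z, u})"
  unfolding incident_edges_eq[OF assms]
  by (subst sum.reindex) (auto simp: inj_on_def doubleton_eq_iff)

lemma card_incident: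
  assumes "simple_graph V E"
  shows "card {e \<in> E. z \<in> e} = degree E z"
  unfolding incident_edges_eq[OF assms] degree_def
  by (rule card_image) (auto simp: inj_on_def doubleton_eq_iff)

text \<open>Regrouping by the end vertices of \<open>e\<close> matches the averages over neighbours
  in the lazy walk. Of the two copies of \<open>w e\<close>, one comes from the diagonal entry and
  one removes \<open>e\<close> from the sum over incident edges.\<close>

lemma ricci_sum:
  assumes G: "simple_graph V E" and e: "e \<in> E"
  shows "(\<Sum>e'\<in>E. ricci_matrix E e e' * w e') =
    (\<Sum>z\<in>e. ((\<Sum>e' | e' \<in> E \<and> z \<in> e'. w e') - 2 * w e) / real (degree E z))"
proof -
  have finE: "finite E" by (rule simple_graph_finite[OF G])
  have fine: "finite e" using G e by (metis card.infinite simple_graph_def zero_neq_numeral)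
  let ?d = "\<lambda>z. real (degree E z)"
  have "(\<Sum>e'\<in>E. ricci_matrix E e e' * w e') =
      ricci_matrix E e e * w e + (\<Sum>e'\<in>E - {e}. ricci_matrix E e e' * w e')"
    using finE e by (rule sum.remove)
  also have "(\<Sum>e'\<in>E - {e}. ricci_matrix E e e' * w e') =
      (\<Sum>e'\<in>E - {e}. \<Sum>z\<in>e. if z \<in> e' then w e' / ?d z else 0)"
  proof (intro sum.cong refl)
    fix e' assume "e' \<in> E - {e}"
    then have "ricci_matrix E e e' * w e' = (\<Sum>z\<in>e \<inter> e'. w e' / ?d z)"
      by (auto simp: ricci_matrix_def sum_distrib_right)
    then show "ricci_matrix E e e' * w e' = (\<Sum>z\<in>e. if z \<in> e' then w e' / ?d z else 0)"
      using fine by (simp only: sum.inter_restrict)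
  qed
  also have "\<dots> = (\<Sum>z\<in>e. \<Sum>e'\<in>E - {e}. if z \<in> e' then w e' / ?d z else 0)"
    by (rule sum.swap)
  also have "\<dots> = (\<Sum>z\<in>e. ((\<Sum>e' | e' \<in> E \<and> z \<in> e'. w e') - w e) / ?d z)"
  proof (intro sum.cong refl)
    fix z assume z: "z \<in> e"
    have "(\<Sum>e'\<in>E - {e}. if z \<in> e' then w e' / ?d z else 0) = (\<Sum>e'\<in>{e' \<in> E - {e}. z \<in> e'}. w e' / ?d z)"
      by (rule sum.inter_filter[symmetric]) (simp add: finE)
    also have "{e' \<in> E - {e}. z \<in> e'} = {e' \<in> E. z \<in> e'} - {e}" by auto
    also have "(\<Sum>e'\<in>{e' \<in> E. z \<in> e'} - {e}. w e' / ?d z) =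
        (\<Sum>e'\<in>{e' \<in> E. z \<in> e'}. w e' / ?d z) - w e / ?d z"
      using finE e z by (subst sum_diff1) auto
    finally show "(\<Sum>e'\<in>E - {e}. if z \<in> e' then w e' / ?d z else 0) =
        ((\<Sum>e' | e' \<in> E \<and> z \<in> e'. w e') - w e) / ?d z"
      by (simp add: sum_divide_distrib diff_divide_distrib)
  qed
  also have "ricci_matrix E e e * w e + \<dots> = (\<Sum>z\<in>e. - w e / ?d z + ((\<Sum>e' | e' \<in> E \<and> z \<in> e'. w e') - w e) / ?d z)"
    by (simp add: ricci_matrix_def sum.distrib sum_subtractf sum_distrib_right sum_negf)
  also have "\<dots> = (\<Sum>z\<in>e. ((\<Sum>e' | e' \<in> E \<and> z \<in> e'. w e') - 2 * w e) / ?d z)"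
    by (intro sum.cong refl) (simp add: diff_divide_distrib)
  finally show ?thesis .
qed

section \<open>Weighted distance and transport across a single edge\<close>

lemma path_weight_Cons2: "path_weight w (a # b # p) = w {a, b} + path_weight w (b # p)"
  by (simp add: path_weight_def sum.lessThan_Suc_shift del: sum.lessThan_Suc)

lemma path_weight_single [simp]: "path_weight w [a] = 0"
  by (simp add: path_weight_def)

lemma finite_paths:
  assumes "finite V"
  shows "finite {path_weight w p | p. is_path V E u v p}"
proof -
  have "finite {p. set p \<subseteq> V \<and> distinct p}" by (rule finite_subset_distinct[OF assms])
  then have "finite {p. is_path V E u v p}"
    by (rule rev_finite_subset) (auto simp: is_path_def)
  then show ?thesis by simp
qed

lemma wdist_le_path_weight:
  assumes "finite V" "is_path V E u v p"
  shows "wdist V E w u v \<le> path_weight w p"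
  unfolding wdist_def using assms by (intro Min_le finite_paths) auto

text \<open>The differences of \<open>f\<close> telescope along the path.\<close>

lemma path_weight_ge_potential:
  assumes "\<And>a b. {a, b} \<in> E \<Longrightarrow> f a - f b \<le> w {a, b}" "is_path V E u v p"
  shows "f u - f v \<le> path_weight w p"
  using assms(2)
proof (induction p arbitrary: u)
  case (Cons a p)
  show ?case
  proof (cases p)
    case Nil
    then show ?thesis using Cons.prems by (auto simp: is_path_def)
  next
    case (Cons b q)
    then have "is_path V E b v p" "{u, b} \<in> E" "a = u"
      using Cons.prems by (auto simp: is_path_def)
    then show ?thesis
      using Cons.IH[of b] assms(1)[of u b] Cons by (simp add: path_weight_Cons2)
  qed
qed (simp add: is_path_def)

lemma wdist_ge_potential:
  assumes "finite V" "connected_graph V E" "\<And>a b. {a, b} \<in> E \<Longrightarrow> f a - f b \<le> w {a, b}"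
    and "u \<in> V" "v \<in> V"
  shows "f u - f v \<le> wdist V E w u v"
proof -
  have "{path_weight w p | p. is_path V E u v p} \<noteq> {}"
    using assms(2,4,5) unfolding connected_graph_def by blast
  then have "wdist V E w u v \<in> {path_weight w p | p. is_path V E u v p}"
    unfolding wdist_def by (intro Min_in finite_paths assms(1))
  then show ?thesis using path_weight_ge_potential[where f = f and w = w, OF assms(3)] by auto
qed

text \<open>A function that is 1-Lipschitz along edges and descends with maximal slope along each path
  \<open>z, x, y, z'\<close> through the edge \<open>{x, y}\<close>.\<close>

definition edge_potential :: "'a set set \<Rightarrow> ('a set \<Rightarrow> real) \<Rightarrow> 'a \<Rightarrow> 'a \<Rightarrow> ('a \<Rightarrow> real) \<Rightarrow> bool" where
  "edge_potential E w x y f \<longleftrightarrow>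
     (\<forall>a b. {a, b} \<in> E \<longrightarrow> f a - f b \<le> w {a, b}) \<and> f x = w {x, y} \<and> f y = 0 \<and>
     (\<forall>z\<in>neighbours E x - {y}. f z = w {x, y} + w {x, z}) \<and>
     (\<forall>z\<in>neighbours E y - {x}. f z = - w {y, z})"

text \<open>Reflecting the values reverses the descent, so a cycle edge has to be treated in one
  orientation only.\<close>

lemma edge_potential_swap:
  assumes "edge_potential E w x y f"
  shows "edge_potential E w y x (\<lambda>u. w {x, y} - f u)"
  unfolding edge_potential_def
proof (intro conjI allI impI)
  fix a b assume "{a, b} \<in> E"
  then have "{b, a} \<in> E" by (simp add: insert_commute)
  then show "w {x, y} - f a - (w {x, y} - f b) \<le> w {a, b}"
    using assms unfolding edge_potential_def by (fastforce simp: insert_commute)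
qed (use assms in \<open>auto simp: edge_potential_def insert_commute\<close>)

lemma expectation_lazy_walk:
  assumes "finite (neighbours E x)" "neighbours E x \<noteq> {}" "0 \<le> \<alpha>" "\<alpha> \<le> 1"
  shows "measure_pmf.expectation (lazy_walk E \<alpha> x) f =
    \<alpha> * f x + (1 - \<alpha>) * ((\<Sum>z\<in>neighbours E x. f z) / real (degree E x))"
proof -
  have "measure_pmf.expectation (lazy_walk E \<alpha> x) f =
     (\<Sum>b\<in>UNIV. pmf (bernoulli_pmf \<alpha>) b *\<^sub>R
       measure_pmf.expectation (if b then return_pmf x else pmf_of_set (neighbours E x)) f)"
    unfolding lazy_walk_def using assms by (intro pmf_expectation_bind) auto
  also have "\<dots> = \<alpha> * f x + (1 - \<alpha>) * ((\<Sum>z\<in>neighbours E x. f z) / real (degree E x))"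
    using assms by (simp add: UNIV_bool integral_pmf_of_set degree_def)
  finally show ?thesis .
qed

lemma pmf_lazy_walk:
  assumes "finite (neighbours E x)" "neighbours E x \<noteq> {}" "0 \<le> \<alpha>" "\<alpha> \<le> 1"
  shows "pmf (lazy_walk E \<alpha> x) z =
    (if z = x then \<alpha> else 0) + (if z \<in> neighbours E x then (1 - \<alpha>) / real (degree E x) else 0)"
  unfolding lazy_walk_def pmf_bind
  using assms by (auto simp: degree_def indicator_def)

lemma set_lazy_walk:
  assumes "finite (neighbours E x)" "neighbours E x \<noteq> {}"
  shows "set_pmf (lazy_walk E \<alpha> x) \<subseteq> insert x (neighbours E x)"
  by (auto simp: lazy_walk_def set_pmf_of_set[OF assms(2,1)] split: if_splits)

lemma has_lly_curvature_potential:
  assumes G: "simple_graph V E" "connected_graph V E" and w: "\<And>e. e \<in> E \<Longrightarrow> w e > 0"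
    and xy: "{x, y} \<in> E" and f: "edge_potential E w x y f"
  shows "has_lly_curvature V E w x y
    (- (\<Sum>e\<in>E. ricci_matrix E {x, y} e * w e) / w {x, y})"
proof -
  let ?D = "wdist V E w" and ?N = "neighbours E"
  define t where "t = w {x, y}"
  have t: "t > 0" using w xy by (simp add: t_def)
  have finV: "finite V" using G(1) by (simp add: simple_graph_def)
  have yx: "{y, x} \<in> E" using xy by (simp add: insert_commute)
  have V: "x \<in> V" "y \<in> V" "x \<noteq> y" using simple_graph_edge[OF G(1) xy] by auto
  have N: "finite (?N z)" "z \<notin> ?N z" "?N z \<subseteq> V" for z
    using simple_graph_neighbours[OF G(1)] by auto
  have Nxy: "y \<in> ?N x" "x \<in> ?N y" using xy yx by (auto simp: neighbours_def)
  then have ne: "?N x \<noteq> {}" "?N y \<noteq> {}" by auto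
  have lip: "f a - f b \<le> w {a, b}" if "{a, b} \<in> E" for a b
    using f that by (simp add: edge_potential_def)
  have fx: "f x = t" and fy: "f y = 0"
    and fz: "\<And>z. z \<in> ?N x - {y} \<Longrightarrow> f z = t + w {x, z}"
    and fz': "\<And>z. z \<in> ?N y - {x} \<Longrightarrow> f z = - w {y, z}"
    using f by (auto simp: edge_potential_def t_def)
  have wN: "w {a, z} > 0" if "z \<in> ?N a" for a z using that w by (auto simp: neighbours_def)
  have upper: "f z > t" if "z \<in> ?N x - {y}" for z using fz[OF that] wN[of z x] that by auto
  have lower: "f z < 0" if "z \<in> ?N y - {x}" for z using fz'[OF that] wN[of z y] that by auto
  have ge: "f u - f v \<le> ?D u v" if "u \<in> V" "v \<in> V" for u v
    using wdist_ge_potential[where f = f and w = w, OF finV G(2) lip that] .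
  have le: "?D u v \<le> path_weight w p" if "is_path V E u v p" for u v p
    using wdist_le_path_weight[OF finV that] .
  have path_xy: "is_path V E x y [x, y]" using V xy by (simp add: is_path_def)
  have path_zy: "is_path V E z y [z, x, y]" if "z \<in> ?N x - {y}" for z
    using that V xy N(2)[of x] N(3)[of x] by (auto simp: is_path_def neighbours_def insert_commute)
  have path_xz: "is_path V E x z [x, y, z]" if "z \<in> ?N y - {x}" for z
    using that V xy N(2)[of y] N(3)[of y] by (auto simp: is_path_def neighbours_def insert_commute)
  have path_zz: "is_path V E z z' [z, x, y, z']" if "z \<in> ?N x - {y}" "z' \<in> ?N y - {x}" for z z'
  proof -
    \<comment> \<open>The potential itself rules out a triangle on \<open>{x, y}\<close>: it exceeds
      \<open>t\<close> at \<open>z\<close> and is negative at \<open>z'\<close>.\<close>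
    have "z \<noteq> z'" using upper[OF that(1)] lower[OF that(2)] t by auto
    then show ?thesis
      using that V xy N(2,3)[of x] N(2,3)[of y] by (auto simp: is_path_def neighbours_def insert_commute)
  qed
  \<comment> \<open>The potential bounds the distance from below and the explicit path through
    \<open>{x, y}\<close> bounds it from above; on these pairs the two bounds coincide.\<close>
  have tight: "?D u v = f u - f v"
    if uv: "u \<in> insert x (?N x - {y})" "v \<in> insert y (?N y - {x})" for u v
  proof (rule antisym)
    show "f u - f v \<le> ?D u v" using uv V N(3) by (intro ge) auto
    consider "u = x" "v = y" | "u = x" "v \<in> ?N y - {x}" | "u \<in> ?N x - {y}" "v = y"
      | "u \<in> ?N x - {y}" "v \<in> ?N y - {x}" using uv by blast
    then show "?D u v \<le> f u - f v"
    proof cases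
      case 1
      then show ?thesis using le[OF path_xy] fx fy by (simp add: path_weight_Cons2 t_def)
    next
      case 2
      then show ?thesis using le[OF path_xz] fx fz' by (simp add: path_weight_Cons2 t_def)
    next
      case 3
      then show ?thesis using le[OF path_zy] fy fz by (simp add: path_weight_Cons2 t_def insert_commute add.commute)
    next
      case 4
      then show ?thesis using le[OF path_zz] fz fz' by (simp add: path_weight_Cons2 t_def insert_commute algebra_simps)
    qed
  qed
  have Dxy: "?D x y = t" using tight[of x y] fx fy by simp
  have diag: "?D u u = 0" if "u \<in> V" for u
    using le[of u u "[u]"] ge[OF that that] that by (simp add: is_path_def)
  define dx dy where "dx = real (degree E x)" and "dy = real (degree E y)"
  have d: "dx \<ge> 1" "dy \<ge> 1"
    using ne N(1) by (simp_all add: dx_def dy_def degree_def Suc_le_eq card_gt_0_iff)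
  define K where "K = (\<Sum>e\<in>E. ricci_matrix E {x, y} e * w e)"
  define sx sy where "sx = (\<Sum>z\<in>?N x. w {x, z})" and "sy = (\<Sum>z\<in>?N y. w {y, z})"
  have K: "K = (sx - 2 * t) / dx + (sy - 2 * t) / dy"
    unfolding K_def ricci_sum[OF G(1) xy] incident_sum[OF G(1)] sx_def sy_def dx_def dy_def t_def
    using V(3) by simp
  have sum_x: "(\<Sum>z\<in>?N x. f z) = (dx - 2) * t + sx"
  proof -
    have "(\<Sum>z\<in>?N x. f z) = f y + (\<Sum>z\<in>?N x - {y}. f z)"
      using N(1) Nxy(1) by (rule sum.remove)
    also have "(\<Sum>z\<in>?N x - {y}. f z) = (\<Sum>z\<in>?N x - {y}. t + w {x, z})"
      by (intro sum.cong refl fz)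
    also have "\<dots> = (dx - 1) * t + (sx - t)"
      using N(1)[of x] Nxy(1) d(1)
      by (simp add: sum.distrib sum_diff1 sx_def t_def dx_def degree_def of_nat_diff card_gt_0_iff Suc_le_eq)
    finally show ?thesis using fy by (simp add: algebra_simps)
  qed
  have sum_y: "(\<Sum>z\<in>?N y. f z) = 2 * t - sy"
  proof -
    have "(\<Sum>z\<in>?N y. f z) = f x + (\<Sum>z\<in>?N y - {x}. f z)"
      using N(1) Nxy(2) by (rule sum.remove)
    also have "(\<Sum>z\<in>?N y - {x}. f z) = (\<Sum>z\<in>?N y - {x}. - w {y, z})"
      by (intro sum.cong refl fz')
    also have "\<dots> = t - sy"
      using N(1)[of y] Nxy(2) by (simp add: sum_negf sum_diff1 sy_def t_def insert_commute)
    finally show ?thesis using fx by simp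
  qed
  have W: "wasserstein ?D (lazy_walk E \<alpha> x) (lazy_walk E \<alpha> y) = t + (1 - \<alpha>) * K"
    if \<alpha>: "1/2 < \<alpha>" "\<alpha> < 1" for \<alpha>
  proof -
    have \<alpha>01: "0 \<le> \<alpha>" "\<alpha> \<le> 1" using \<alpha> by auto
    note px = pmf_lazy_walk[OF N(1) ne(1) \<alpha>01] and py = pmf_lazy_walk[OF N(1) ne(2) \<alpha>01]
    have supp: "set_pmf (lazy_walk E \<alpha> x) \<subseteq> insert x (?N x)" "set_pmf (lazy_walk E \<alpha> y) \<subseteq> insert y (?N y)"
      using set_lazy_walk[OF N(1)] ne by auto
    \<comment> \<open>Since \<open>\<alpha> > 1/2\<close> and degrees are at least 1, each end of
      the edge keeps more mass under its own walk than it receives from the other walk. Hence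
      \<open>y\<close> is never a source and \<open>x\<close> never a sink.\<close>
    have stay: "(1 - \<alpha>) / dx < \<alpha>" "(1 - \<alpha>) / dy < \<alpha>"
    proof -
      have "(1 - \<alpha>) / dx \<le> (1 - \<alpha>) / 1" "(1 - \<alpha>) / dy \<le> (1 - \<alpha>) / 1"
        using d \<alpha> by (intro divide_left_mono; simp)+
      moreover have "(1 - \<alpha>) / 1 < \<alpha>" using \<alpha> by simp
      ultimately show "(1 - \<alpha>) / dx < \<alpha>" "(1 - \<alpha>) / dy < \<alpha>"
        by (blast intro: le_less_trans)+
    qed
    have "wasserstein ?D (lazy_walk E \<alpha> x) (lazy_walk E \<alpha> y) =
      measure_pmf.expectation (lazy_walk E \<alpha> x) f - measure_pmf.expectation (lazy_walk E \<alpha> y) f"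
    proof (rule wasserstein_eq_potential)
      show "finite (set_pmf (lazy_walk E \<alpha> x))" "finite (set_pmf (lazy_walk E \<alpha> y))"
        using supp N(1) by (meson finite_insert finite_subset)+
      show "f u - f v \<le> ?D u v" if "u \<in> set_pmf (lazy_walk E \<alpha> x)" "v \<in> set_pmf (lazy_walk E \<alpha> y)" for u v
        using that supp V N(3) by (intro ge) blast+
      show "?D u u = 0" if "u \<in> set_pmf (lazy_walk E \<alpha> x)" for u
        using that supp V N(3) by (intro diag) blast
      fix u v
      assume u: "pmf (lazy_walk E \<alpha> x) u > pmf (lazy_walk E \<alpha> y) u"
        and v: "pmf (lazy_walk E \<alpha> y) v > pmf (lazy_walk E \<alpha> x) v"
      have "u \<noteq> y" using u stay(1) V(3) Nxy N(2) by (auto simp: px py dx_def)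
      moreover have "u \<in> insert x (?N x)"
        using u supp(1) by (metis in_mono not_less pmf_nonneg set_pmf_iff)
      moreover have "v \<noteq> x" using v stay(2) V(3) Nxy N(2) by (auto simp: px py dy_def)
      moreover have "v \<in> insert y (?N y)"
        using v supp(2) by (metis in_mono not_less pmf_nonneg set_pmf_iff)
      ultimately show "?D u v = f u - f v" by (intro tight) auto
    qed
    also have "\<dots> = \<alpha> * t + (1 - \<alpha>) * (((dx - 2) * t + sx) / dx) - (1 - \<alpha>) * ((2 * t - sy) / dy)"
      by (simp add: expectation_lazy_walk[OF N(1) ne(1) \<alpha>01] expectation_lazy_walk[OF N(1) ne(2) \<alpha>01]
          sum_x sum_y fx fy dx_def dy_def)
    also have "((dx - 2) * t + sx) / dx = t + (sx - 2 * t) / dx"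
      using d by (simp add: field_simps)
    also have "(2 * t - sy) / dy = - ((sy - 2 * t) / dy)" by (simp add: minus_divide_left)
    finally show ?thesis unfolding K by (simp add: algebra_simps)
  qed
  have "eventually (\<lambda>\<alpha>. \<alpha> \<in> {1/2<..<1}) (at_left (1::real))"
    by (rule eventually_at_leftI[of "1/2"]) auto
  \<comment> \<open>The cost is exactly affine in \<open>1 - \<alpha>\<close>, so the quotient is
    already constant for \<open>\<alpha>\<close> between 1/2 and 1 and the limit is
    immediate.\<close>
  then have "eventually (\<lambda>\<alpha>. - K / t = alpha_curvature V E w \<alpha> x y / (1 - \<alpha>)) (at_left 1)"
  proof eventually_elim
    case (elim \<alpha>)
    then show ?case using t by (simp add: alpha_curvature_def W Dxy add_divide_distrib)
  qed
  then have "((\<lambda>\<alpha>. alpha_curvature V E w \<alpha> x y / (1 - \<alpha>)) \<longlongrightarrow> - K / t) (at_left 1)"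
    by (rule tendsto_eventually[OF eventually_mono]) simp
  then show ?thesis by (simp add: has_lly_curvature_def K_def t_def)
qed

section \<open>Unicyclic graphs\<close>

lemma linked_doubleton: "{a, b} = {p, q} \<Longrightarrow> linked G p q \<Longrightarrow> linked G a b"
  using linked_sym[of G p q] by (auto simp: doubleton_eq_iff)

lemma mod_neq_of_less: "k mod n \<noteq> i mod n" if "i < k" "k < i + n" for i k n :: nat
proof
  assume "k mod n = i mod n"
  then have "n dvd k - i" using that(1) by (simp add: mod_eq_dvd_iff_nat)
  then have "n \<le> k - i" using that(1) by (intro dvd_imp_le) auto
  then show False using that by linarith
qed

lemma exists_shift_mod: "\<exists>j<n. (i + j) mod n = k mod n" if "0 < n" for i k n :: nat
proof (intro exI conjI)
  have "i mod n \<le> n" using that by (simp add: less_imp_le)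
  then have "i + (k + (n - i mod n)) = k + n + (i - i mod n)" by (simp add: mod_less_eq_dividend)
  also have "\<dots> = k + n * (i div n + 1)" by (simp add: minus_mod_eq_mult_div algebra_simps)
  finally have "(i + (k + (n - i mod n))) mod n = k mod n"
    by (simp only: mod_mult_self2)
  then show "(i + (k + (n - i mod n)) mod n) mod n = k mod n" by (simp add: mod_add_right_eq)
qed (use that in simp)

locale unicyclic_cycle =
  fixes V :: "'a set" and E :: "'a set set" and c :: "'a list"
  assumes unicyclic: "unicyclic V E" and cycle: "is_cycle V E c"
begin

abbreviation n where "n \<equiv> length c"
abbreviation vx where "vx i \<equiv> c ! (i mod length c)"
abbreviation C where "C \<equiv> cycle_edges c"
abbreviation F where "F \<equiv> E - cycle_edges c"

lemma graph: "simple_graph V E" "connected_graph V E" "card E = card V"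
  using unicyclic by (auto simp: unicyclic_def)

lemma finite_V: "finite V" and finite_E: "finite E"
  using graph simple_graph_finite by (auto simp: simple_graph_def)

lemma edge_subset: "e \<in> E \<Longrightarrow> e \<subseteq> V"
  using graph by (simp add: simple_graph_def)

lemma n_ge_3: "3 \<le> n" and C_subset: "C \<subseteq> E" and distinct_c: "distinct c"
  using cycle by (auto simp: is_cycle_def)

lemma n_pos: "0 < n"
  using n_ge_3 by linarith

lemma vx_in_V: "vx i \<in> V"
  using cycle n_pos by (auto simp: is_cycle_def)

lemma vx_eq_iff: "vx i = vx j \<longleftrightarrow> i mod n = j mod n"
  using distinct_c n_pos by (simp add: nth_eq_iff_index_eq)

lemma cycle_edge_mod: "cycle_edge c (i mod n) = cycle_edge c i"
  by (simp add: cycle_edge_def mod_Suc_eq)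

lemma cycle_edge_in_C: "cycle_edge c i \<in> C"
  unfolding cycle_edges_def using n_pos
  by (intro image_eqI[of _ _ "i mod n"]) (auto simp: cycle_edge_mod)

lemma cycle_edge_in_E: "cycle_edge c i \<in> E"
  using cycle_edge_in_C C_subset by blast

lemma cycle_edge_eq_iff: "cycle_edge c i = cycle_edge c j \<longleftrightarrow> i mod n = j mod n"
proof
  assume eq: "cycle_edge c i = cycle_edge c j"
  show "i mod n = j mod n"
  proof (rule ccontr)
    assume "i mod n \<noteq> j mod n"
    \<comment> \<open>Distinct indices could only give the same edge traversed backwards, which
      would force \<open>j + 2\<close> and \<open>j\<close> to agree modulo \<open>n\<close>; length
      at least 3 forbids this.\<close>
    then have "i mod n = Suc j mod n" "Suc i mod n = j mod n"
      using eq unfolding cycle_edge_def doubleton_eq_iff vx_eq_iff by auto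
    then have "(j + 2) mod n = j mod n" by (metis mod_Suc_eq add_2_eq_Suc')
    then show False using mod_neq_of_less[of j "j + 2" n] n_ge_3 by simp
  qed
next
  assume "i mod n = j mod n"
  then show "cycle_edge c i = cycle_edge c j" by (metis cycle_edge_mod)
qed

lemma cycle_edgeE:
  assumes "e \<in> C"
  obtains i where "e = {vx i, vx (Suc i)}"
  using assms unfolding cycle_edges_def cycle_edge_def by blast

lemma card_C: "card C = n"
  unfolding cycle_edges_def by (subst card_image) (auto simp: inj_on_def cycle_edge_eq_iff)

text \<open>Without \<open>e\<close> and \<open>e'\<close> the graph would stay connected with only
  \<open>card V - 2\<close> edges, one fewer than connectivity allows.\<close>

lemma not_two_redundant_edges:
  assumes e: "e \<in> E" "e' \<in> E" "e \<noteq> e'"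
    and red: "\<And>a b. {a, b} \<in> E \<Longrightarrow> linked (E - {e, e'}) a b"
  shows False
proof -
  have "card V \<le> card (E - {e, e'}) + 1"
  proof (rule connected_card_le)
    show "linked (E - {e, e'}) (vx 0) v" if "v \<in> V" for v
      using connected_graph_linked[OF graph(2) vx_in_V that] red by (rule linked_subst)
    show "vx 0 \<in> V" by (rule vx_in_V)
  qed (use finite_V finite_E edge_subset in auto)
  also have "card (E - {e, e'}) = card E - 2"
    using e finite_E by (subst card_Diff_subset) auto
  finally have "card E \<le> card E - 2 + 1" using graph(3) by simp
  moreover have "card {e, e'} \<le> card E" using e finite_E by (intro card_mono) auto
  ultimately show False using e(3) by simp
qed

text \<open>Indices are not reduced modulo \<open>n\<close>, so an arc may run past the end of the
  list and close up at \<open>i + n\<close>.\<close>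

lemma linked_arc:
  assumes "i \<le> j" "\<And>k. i \<le> k \<Longrightarrow> k < j \<Longrightarrow> cycle_edge c k \<in> H"
  shows "linked H (vx i) (vx j)"
  using assms
proof (induction j rule: dec_induct)
  case (step j)
  then have "linked H (vx i) (vx j)" by simp
  moreover have "{vx j, vx (Suc j)} \<in> H" using step by (auto simp: cycle_edge_def)
  ultimately show ?case by (rule rtranclp.rtrancl_into_rtrancl)
qed simp

lemma linked_complementary_arc:
  assumes "C - {cycle_edge c i} \<subseteq> H"
  shows "linked H (vx i) (vx (Suc i))"
proof -
  have "linked H (vx (Suc i)) (vx (i + n))"
  proof (rule linked_arc)
    fix k assume "Suc i \<le> k" "k < i + n"
    then show "cycle_edge c k \<in> H"
      using assms cycle_edge_in_C mod_neq_of_less[of i k n] by (auto simp: cycle_edge_eq_iff)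
  qed (use n_pos in linarith)
  then show ?thesis using linked_sym by simp
qed

text \<open>Otherwise \<open>{x, y}\<close> and a cycle edge would both be redundant: the cycle edge
  is bypassed by the rest of the cycle, which avoids \<open>{x, y}\<close>, and this detour also
  replaces it in the walk from \<open>x\<close> to \<open>y\<close>.\<close>

lemma bridge:
  assumes "{x, y} \<in> F"
  shows "\<not> linked (E - {{x, y}}) x y"
proof
  assume xy: "linked (E - {{x, y}}) x y"
  define e where "e = {x, y}"
  define e' where "e' = cycle_edge c 0"
  let ?H = "E - {e, e'}"
  have e': "e' \<in> C" using cycle_edge_in_C by (simp add: e'_def)
  have ends': "linked ?H (vx 0) (vx (Suc 0))"
    by (rule linked_complementary_arc) (use C_subset assms in \<open>auto simp: e_def e'_def\<close>)
  have ends: "linked ?H x y"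
  proof (rule linked_insert_cases[OF xy _ _ ends'])
    show "linked ?H a b" if "{a, b} \<in> E - {{x, y}} - {e'}" for a b
      using that by (intro linked_edge) (auto simp: e_def)
  qed (simp add: e'_def cycle_edge_def)
  show False
  proof (rule not_two_redundant_edges)
    show "e \<in> E" "e' \<in> E" "e \<noteq> e'" using assms e' C_subset by (auto simp: e_def)
    show "linked ?H a b" if ab: "{a, b} \<in> E" for a b
    proof -
      consider "{a, b} = e" | "{a, b} = e'" | "{a, b} \<in> ?H" using ab by blast
      then show ?thesis
      proof cases
        case 1
        then show ?thesis
          by (intro linked_doubleton[OF _ ends]) (simp only: e_def cycle_edge_def)
      next
        case 2
        then show ?thesis
          by (intro linked_doubleton[OF _ ends']) (simp only: e'_def cycle_edge_def)
      next
        case 3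
        then show ?thesis by (rule linked_edge)
      qed
    qed
  qed
qed

text \<open>A connection off the cycle would act as a chord. Removing one edge from each of the two
  arcs between its ends leaves everything linked, so two edges would be redundant.\<close>

lemma cycle_vertices_unlinked_less:
  assumes "i < j" "j < n" and ij: "linked F (vx i) (vx j)"
  shows False
proof -
  define e e' where "e = cycle_edge c i" and "e' = cycle_edge c j"
  let ?H = "E - {e, e'}"
  have H: "cycle_edge c k \<in> ?H" if "k mod n \<noteq> i mod n" "k mod n \<noteq> j mod n" for k
    using that cycle_edge_in_E by (simp add: e_def e'_def cycle_edge_eq_iff)
  have ij': "linked ?H (vx i) (vx j)"
    using ij
  proof (rule linked_subst)
    fix a b assume "{a, b} \<in> F"
    then show "linked ?H a b"
      using cycle_edge_in_C by (intro linked_edge) (auto simp: e_def e'_def)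
  qed
  have arc: "linked ?H (vx (Suc i)) (vx j)"
  proof (rule linked_arc)
    fix k assume "Suc i \<le> k" "k < j"
    then show "cycle_edge c k \<in> ?H"
      using assms(1,2) mod_neq_of_less[of i k n] mod_neq_of_less[of k j n] by (intro H) auto
  qed (use assms in simp)
  have "linked ?H (vx (Suc j)) (vx (i + n))"
  proof (rule linked_arc)
    fix k assume "Suc j \<le> k" "k < i + n"
    then show "cycle_edge c k \<in> ?H"
      using assms(1,2) mod_neq_of_less[of i k n] mod_neq_of_less[of j k n] by (intro H) auto
  qed (use assms in simp)
  then have arc': "linked ?H (vx (Suc j)) (vx i)" by simp
  have ends: "linked ?H (vx i) (vx (Suc i))"
    using ij' linked_sym[OF arc] by (rule rtranclp_trans)
  have ends': "linked ?H (vx j) (vx (Suc j))"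
    using linked_sym[OF ij'] linked_sym[OF arc'] by (rule rtranclp_trans)
  show False
  proof (rule not_two_redundant_edges)
    show "e \<in> E" "e' \<in> E" using cycle_edge_in_E by (simp_all add: e_def e'_def)
    show "e \<noteq> e'" using assms by (simp add: e_def e'_def cycle_edge_eq_iff)
    show "linked ?H a b" if ab: "{a, b} \<in> E" for a b
    proof -
      consider "{a, b} = e" | "{a, b} = e'" | "{a, b} \<in> ?H" using ab by blast
      then show ?thesis
      proof cases
        case 1
        then show ?thesis
          by (intro linked_doubleton[OF _ ends]) (simp only: e_def cycle_edge_def)
      next
        case 2
        then show ?thesis
          by (intro linked_doubleton[OF _ ends']) (simp only: e'_def cycle_edge_def)
      next
        case 3
        then show ?thesis by (rule linked_edge)
      qed
    qed
  qed
qed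

lemma cycle_vertices_unlinked:
  assumes "linked F (vx i) (vx j)"
  shows "i mod n = j mod n"
proof (rule ccontr)
  assume "i mod n \<noteq> j mod n"
  moreover have "linked F (vx (i mod n)) (vx (j mod n))" "linked F (vx (j mod n)) (vx (i mod n))"
    using assms linked_sym[OF assms] by simp_all
  moreover have "i mod n < n" "j mod n < n" using n_pos by simp_all
  ultimately show False
    using cycle_vertices_unlinked_less by (metis linorder_neqE_nat)
qed

text \<open>An edge leaving the set reached from the cycle cannot exist: a cycle edge ends on the
  cycle, and any other edge extends the reach. With \<open>cycle_vertices_unlinked\<close> this
  partitions \<open>V\<close> into the pendant trees.\<close>

lemma linked_to_cycle:
  assumes "v \<in> V"
  shows "\<exists>j. linked F (vx j) v"
proof (rule ccontr)
  assume no: "\<nexists>j. linked F (vx j) v"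
  define U where "U = {u. \<exists>j. linked F (vx j) u}"
  have "vx 0 \<in> U" unfolding U_def by blast
  moreover have "v \<notin> U" using no by (simp add: U_def)
  ultimately obtain a b where ab: "a \<in> U" "b \<notin> U" "{a, b} \<in> E"
    by (rule linked_crossing_edge[OF connected_graph_linked[OF graph(2) vx_in_V assms]])
  have "b \<in> U"
  proof (cases "{a, b} \<in> C")
    case True
    then obtain k where "{a, b} = {vx k, vx (Suc k)}" by (rule cycle_edgeE)
    then have "b = vx k \<or> b = vx (Suc k)" by (auto simp: doubleton_eq_iff)
    then show ?thesis by (auto simp: U_def)
  next
    case False
    then obtain j where "linked F (vx j) a" "{a, b} \<in> F" using ab by (auto simp: U_def)
    then have "linked F (vx j) b" by (rule rtranclp.rtrancl_into_rtrancl)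
    then show ?thesis by (auto simp: U_def)
  qed
  then show False using ab by simp
qed

text \<open>The pendant tree containing \<open>u\<close> hangs off the cycle vertex \<open>root i u\<close> steps after \<open>vx i\<close>.\<close>

definition root :: "nat \<Rightarrow> 'a \<Rightarrow> nat" where
  "root i u = (SOME j. j < n \<and> linked F (vx (i + j)) u)"

lemma root_linked:
  assumes "v \<in> V"
  shows "root i v < n" "linked F (vx (i + root i v)) v"
proof -
  obtain k where k: "linked F (vx k) v" using linked_to_cycle[OF assms] by blast
  obtain j where "j < n" "(i + j) mod n = k mod n" using exists_shift_mod[OF n_pos] by blast
  then have "j < n \<and> linked F (vx (i + j)) v" using k by simp
  then have "root i v < n \<and> linked F (vx (i + root i v)) v"
    unfolding root_def by (rule someI)
  then show "root i v < n" "linked F (vx (i + root i v)) v" by auto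
qed

lemma root_unique:
  assumes "linked F (vx (i + j)) v" "j < n" "v \<in> V"
  shows "root i v = j"
proof -
  have "linked F (vx (i + root i v)) (vx (i + j))"
    using root_linked(2)[OF assms(3)] linked_sym[OF assms(1)] by (rule rtranclp_trans)
  then have eq: "(i + root i v) mod n = (i + j) mod n" by (rule cycle_vertices_unlinked)
  show ?thesis
  proof (rule ccontr)
    assume "root i v \<noteq> j"
    then show False
      using eq assms(2) root_linked(1)[OF assms(3), of i]
        mod_neq_of_less[of "i + j" "i + root i v" n] mod_neq_of_less[of "i + root i v" "i + j" n]
      by linarith
  qed
qed

lemma root_vx: "j < n \<Longrightarrow> root i (vx (i + j)) = j"
  by (rule root_unique) (auto intro: vx_in_V)

lemma root_edge:
  assumes "{a, b} \<in> F"
  shows "root i a = root i b"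
proof -
  have "a \<in> V" "b \<in> V" using assms edge_subset by auto
  then have a: "root i a < n" "linked F (vx (i + root i a)) a" and b: "b \<in> V"
    using root_linked by auto
  have "linked F (vx (i + root i a)) b"
    using a(2) assms by (rule rtranclp.rtrancl_into_rtrancl)
  then show ?thesis using root_unique a(1) b by simp
qed

lemma cycle_edge_cases:
  assumes "{a, b} \<in> C"
  obtains j where "j < n" "{a, b} = {vx (i + j), vx (i + Suc j)}"
proof -
  obtain k where k: "{a, b} = cycle_edge c k" using assms by (auto simp: cycle_edges_def)
  obtain j where j: "j < n" "(i + j) mod n = k mod n" using exists_shift_mod[OF n_pos] by blast
  then have "{a, b} = cycle_edge c (i + j)" using k by (simp add: cycle_edge_eq_iff)
  then show ?thesis using that j(1) by (simp add: cycle_edge_def)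
qed

end

section \<open>Edge potentials for weights that are constant on the cycle\<close>

locale cycle_constant_weight = unicyclic_cycle +
  fixes w :: "'a set \<Rightarrow> real" and t :: real
  assumes w_pos: "\<And>e. e \<in> E \<Longrightarrow> w e > 0" and w_cycle: "\<And>e. e \<in> C \<Longrightarrow> w e = t"
begin

lemma t_pos: "t > 0"
  using w_pos[OF cycle_edge_in_E] w_cycle[OF cycle_edge_in_C] by simp

text \<open>Two neighbours of \<open>x\<close> in one component of \<open>G - x\<close> are the cycle neighbours of \<open>x\<close>, so they
  carry equal weights and the function below is well defined.\<close>

lemma star_function:
  obtains h where "h x = 0" "\<And>z. {x, z} \<in> E \<Longrightarrow> h z = w {x, z}"
    "\<And>a b. {a, b} \<in> E \<Longrightarrow> h a - h b \<le> w {a, b}"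
proof -
  define S where "S = {e \<in> E. x \<notin> e}"
  \<comment> \<open>\<open>Q u\<close> picks out the neighbours of \<open>x\<close> in the component
    of \<open>u\<close> after \<open>x\<close> is removed. It is the same predicate at both ends of
    an edge avoiding \<open>x\<close>, so \<open>SOME\<close> makes the same choice there and
    \<open>h\<close> is constant on each component.\<close>
  define Q where "Q = (\<lambda>u z. {x, z} \<in> E \<and> linked S z u)"
  define h where "h = (\<lambda>u. if u = x then 0 else w {x, SOME z. Q u z})"
  \<comment> \<open>A second neighbour in the same component yields a detour around
    \<open>{x, z}\<close>, so this edge is not a bridge and must lie on the cycle.\<close>
  have in_C: "{x, z} \<in> C"
    if "{x, z} \<in> E" "{x, z'} \<in> E" "linked S z' z" "z \<noteq> z'" for z z'
  proof (rule ccontr)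
    assume "{x, z} \<notin> C"
    moreover have "linked (E - {{x, z}}) x z"
    proof (rule converse_rtranclp_into_rtranclp)
      show "{x, z'} \<in> E - {{x, z}}" using that by (auto simp: doubleton_eq_iff)
      show "linked (E - {{x, z}}) z' z"
        using that(3) by (rule linked_subst) (auto simp: S_def intro!: linked_edge)
    qed
    ultimately show False using bridge[of x z] that(1) by blast
  qed
  have hx: "h x = 0" by (simp add: h_def)
  have hz: "h z = w {x, z}" if z: "{x, z} \<in> E" for z
  proof -
    define z' where "z' = (SOME z'. Q z z')"
    have "Q z z" using z by (simp add: Q_def)
    then have "Q z z'" unfolding z'_def by (rule someI)
    then have z': "{x, z'} \<in> E" "linked S z' z" by (auto simp: Q_def)
    have "w {x, z'} = w {x, z}"
    proof (cases "z = z'")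
      case False
      then have "{x, z} \<in> C" "{x, z'} \<in> C"
        using in_C z z' linked_sym[OF z'(2)] by auto
      then show ?thesis by (simp add: w_cycle)
    qed simp
    moreover have "z \<noteq> x" using simple_graph_edge(1)[OF graph(1) z] by auto
    ultimately show ?thesis by (simp add: h_def z'_def)
  qed
  have "h a = h b" if "{a, b} \<in> E" "x \<notin> {a, b}" for a b
  proof -
    have ab: "linked S a b" using that by (intro linked_edge) (simp add: S_def)
    have "Q a = Q b"
      using ab linked_sym[OF ab] by (auto simp: Q_def fun_eq_iff intro: rtranclp_trans)
    then show ?thesis using that(2) by (auto simp: h_def)
  qed
  then have "h a - h b \<le> w {a, b}" if "{a, b} \<in> E" for a b
    using that hx hz[of a] hz[of b] w_pos[OF that]
    by (cases "x = a"; cases "x = b") (auto simp: insert_commute)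
  then show ?thesis using that hx hz by blast
qed

text \<open>Removing the bridge separates the two sides, so the star functions at \<open>x\<close>
  and \<open>y\<close> can be used independently: added above \<open>w {x, y}\<close> on the side of
  \<open>x\<close>, subtracted from 0 on the side of \<open>y\<close>. Only the bridge joins the two
  definitions.\<close>

lemma edge_potential_bridge:
  assumes xy: "{x, y} \<in> F"
  shows "\<exists>f. edge_potential E w x y f"
proof -
  let ?H = "E - {{x, y}}"
  obtain hx where hx: "hx x = 0" "\<And>z. {x, z} \<in> E \<Longrightarrow> hx z = w {x, z}"
    "\<And>a b. {a, b} \<in> E \<Longrightarrow> hx a - hx b \<le> w {a, b}" by (rule star_function[of x]) blast
  obtain hy where hy: "hy y = 0" "\<And>z. {y, z} \<in> E \<Longrightarrow> hy z = w {y, z}"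
    "\<And>a b. {a, b} \<in> E \<Longrightarrow> hy a - hy b \<le> w {a, b}" by (rule star_function[of y]) blast
  define f where "f = (\<lambda>u. if linked ?H x u then w {x, y} + hx u else - hy u)"
  have ny: "\<not> linked ?H x y" by (rule bridge[OF xy])
  have fx: "f x = w {x, y}" and fy: "f y = 0" using hx(1) hy(1) ny by (auto simp: f_def)
  have wxy: "w {x, y} > 0" using w_pos xy by blast
  have step: "linked ?H x a \<longleftrightarrow> linked ?H x b" if "{a, b} \<in> ?H" for a b
    using linked_edge[OF that] linked_sym[OF linked_edge[OF that]] by (blast intro: rtranclp_trans)
  have "edge_potential E w x y f"
    unfolding edge_potential_def
  proof (intro conjI allI impI ballI)
    fix a b assume ab: "{a, b} \<in> E"
    show "f a - f b \<le> w {a, b}"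
    proof (cases "{a, b} = {x, y}")
      case True
      then show ?thesis using fx fy wxy by (auto simp: doubleton_eq_iff insert_commute)
    next
      case False
      then have "linked ?H x a \<longleftrightarrow> linked ?H x b" using ab by (intro step) auto
      moreover have "{b, a} \<in> E" "w {b, a} = w {a, b}" using ab by (simp_all add: insert_commute)
      ultimately show ?thesis using hx(3)[OF ab] hy(3)[of b a] by (auto simp: f_def)
    qed
  next
    fix z assume z: "z \<in> neighbours E x - {y}"
    then have "{x, z} \<in> ?H" by (auto simp: neighbours_def doubleton_eq_iff)
    then have "linked ?H x z" by (rule linked_edge)
    then show "f z = w {x, y} + w {x, z}" using z hx(2) by (simp add: f_def neighbours_def)
  next
    fix z assume z: "z \<in> neighbours E y - {x}"
    then have "{y, z} \<in> ?H" by (auto simp: neighbours_def doubleton_eq_iff)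
    then have "\<not> linked ?H x z" using step ny by blast
    then show "f z = - w {y, z}" using z hy(2) by (simp add: f_def neighbours_def)
  qed (use fx fy in auto)
  then show ?thesis by blast
qed

text \<open>Here the potential has to climb from \<open>-t\<close> at \<open>vx (i + 2)\<close> to \<open>2 * t\<close> at \<open>vx (i - 1)\<close> along the
  \<open>n - 3\<close> remaining cycle edges in steps of at most \<open>t\<close>, which is possible if and only if \<open>6 \<le> n\<close>.\<close>

lemma edge_potential_cycle:
  assumes n: "6 \<le> n"
  shows "\<exists>f. edge_potential E w (vx i) (vx (Suc i)) f"
proof -
  let ?x = "vx i" and ?y = "vx (Suc i)"
  obtain hx where hx: "hx ?x = 0" "\<And>z. {?x, z} \<in> E \<Longrightarrow> hx z = w {?x, z}"
    "\<And>a b. {a, b} \<in> E \<Longrightarrow> hx a - hx b \<le> w {a, b}" by (rule star_function[of ?x]) blast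
  obtain hy where hy: "hy ?y = 0" "\<And>z. {?y, z} \<in> E \<Longrightarrow> hy z = w {?y, z}"
    "\<And>a b. {a, b} \<in> E \<Longrightarrow> hy a - hy b \<le> w {a, b}" by (rule star_function[of ?y]) blast
  \<comment> \<open>Indices count from \<open>vx i\<close>. The formula gives \<open>2 * t\<close>
    at \<open>n - 1\<close>, drops by \<open>t\<close> per step backwards and is cut off at
    \<open>-t\<close>; at index 2 the cut-off is in force because \<open>5 - n\<close> is at most
    -1.\<close>
  define \<phi> where "\<phi> = (\<lambda>j::nat. if j = 0 then t else if j = 1 then 0
    else t * max (-1) (real j + 3 - real n))"
  \<comment> \<open>Each pendant tree inherits the value of its root. Only the trees at the two ends
    of the edge are tilted by a star function, to give the non-cycle neighbours there maximal
    slope.\<close>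
  define f where "f = (\<lambda>u. \<phi> (root i u) + (if root i u = 0 then hx u else 0)
    - (if root i u = 1 then hy u else 0))"
  have t: "t > 0" by (rule t_pos)
  have f_vx: "f (vx (i + j)) = \<phi> j" if "j < n" for j
    unfolding f_def root_vx[OF that] using hx(1) hy(1) by auto
  have f_vx_Suc: "f (vx (i + Suc j)) = \<phi> (Suc j mod n)" for j
  proof -
    have "vx (i + Suc j) = vx (i + Suc j mod n)" by (simp add: mod_add_right_eq vx_eq_iff)
    then show ?thesis using f_vx[of "Suc j mod n"] n_pos by simp
  qed
  have root_x: "root i ?x = 0" using root_vx[of 0 i] n_pos by simp
  have root_y: "root i ?y = 1" using root_vx[of 1 i] n by simp
  have fx: "f ?x = t" and fy: "f ?y = 0"
    using f_vx[of 0] f_vx[of 1] n n_pos by (simp_all add: \<phi>_def)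
  have \<phi>_step: "\<bar>\<phi> j - \<phi> (Suc j mod n)\<bar> \<le> t" if j: "j < n" for j
  proof -
    consider "j = 0" | "j = 1" | "2 \<le> j" "Suc j < n" | "Suc j = n" using j by linarith
    then show ?thesis
    proof cases
      case 3
      have "\<phi> j - \<phi> (Suc j mod n) =
          t * (max (-1) (real j + 3 - real n) - max (-1) (real j + 4 - real n))"
        using 3 by (simp add: \<phi>_def algebra_simps)
      also have "\<bar>\<dots>\<bar> = t * \<bar>max (-1) (real j + 3 - real n) - max (-1) (real j + 4 - real n)\<bar>"
        using t by (simp add: abs_mult)
      also have "\<dots> \<le> t * 1" using t by (intro mult_left_mono) (auto simp: max_def)
      finally show ?thesis by simp
    qed (use n t in \<open>auto simp: \<phi>_def max_def\<close>)
  qed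
  have wxy: "w {?x, ?y} = t" using w_cycle[OF cycle_edge_in_C[of i]] by (simp add: cycle_edge_def)
  have "edge_potential E w ?x ?y f"
    unfolding edge_potential_def
  proof (intro conjI allI impI ballI)
    fix a b assume ab: "{a, b} \<in> E"
    show "f a - f b \<le> w {a, b}"
    proof (cases "{a, b} \<in> C")
      case True
      then obtain j where j: "j < n" "{a, b} = {vx (i + j), vx (i + Suc j)}"
        by (rule cycle_edge_cases)
      then have "\<bar>f a - f b\<bar> \<le> t"
        using \<phi>_step[OF j(1)] f_vx[OF j(1)] f_vx_Suc[of j] by (auto simp: doubleton_eq_iff)
      then show ?thesis using w_cycle[OF True] by linarith
    next
      case False
      then have "root i a = root i b" using ab by (intro root_edge) auto
      moreover have "{b, a} \<in> E" "w {b, a} = w {a, b}" using ab by (simp_all add: insert_commute)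
      ultimately show ?thesis
        using hx(3)[OF ab] hy(3)[of b a] w_pos[OF ab] by (auto simp: f_def)
    qed
  next
    fix z assume z: "z \<in> neighbours E ?x - {?y}"
    then have xz: "{?x, z} \<in> E" by (simp add: neighbours_def)
    show "f z = w {?x, ?y} + w {?x, z}"
    proof (cases "{?x, z} \<in> C")
      case True
      then obtain j where j: "j < n" "{?x, z} = {vx (i + j), vx (i + Suc j)}"
        by (rule cycle_edge_cases)
      have "?x \<noteq> vx (i + j) \<or> z \<noteq> vx (i + Suc j)"
      proof (rule ccontr)
        assume "\<not> (?x \<noteq> vx (i + j) \<or> z \<noteq> vx (i + Suc j))"
        then have "j = 0" "z = vx (i + Suc j)" using root_vx[OF j(1), of i] root_x by auto
        then show False using z by simp
      qed
      then have j': "?x = vx (i + Suc j)" "z = vx (i + j)" using j(2) by (auto simp: doubleton_eq_iff)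
      \<comment> \<open>Since \<open>?x\<close> has index 0, the cycle vertex before it has index
        \<open>n - 1\<close>, where \<open>\<phi>\<close> takes the value
        \<open>2 * t\<close>.\<close>
      have "Suc j = n"
      proof (rule ccontr)
        assume "Suc j \<noteq> n"
        then show False using root_vx[of "Suc j" i] j(1) j'(1) root_x by simp
      qed
      then have "f z = 2 * t" using f_vx[OF j(1)] j'(2) n by (auto simp: \<phi>_def)
      then show ?thesis using w_cycle[OF True] wxy by simp
    next
      case False
      then have "root i z = 0" using root_edge[of ?x z i] root_x xz by simp
      then show ?thesis using hx(2)[OF xz] wxy by (simp add: f_def \<phi>_def)
    qed
  next
    fix z assume z: "z \<in> neighbours E ?y - {?x}"
    then have yz: "{?y, z} \<in> E" by (simp add: neighbours_def)
    show "f z = - w {?y, z}"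
    proof (cases "{?y, z} \<in> C")
      case True
      then obtain j where j: "j < n" "{?y, z} = {vx (i + j), vx (i + Suc j)}"
        by (rule cycle_edge_cases)
      have "?y = vx (i + j) \<and> z = vx (i + Suc j)"
      proof (rule ccontr)
        assume "\<not> ?thesis"
        then have j': "?y = vx (i + Suc j)" "z = vx (i + j)" using j(2) by (auto simp: doubleton_eq_iff)
        have "Suc j \<noteq> n"
        proof
          assume "Suc j = n"
          then have "?y = vx (i + n)" using j'(1) by (simp only:)
          then show False using root_x root_y by simp
        qed
        then have "root i (vx (i + Suc j)) = Suc j" using j(1) by (intro root_vx) simp
        then have "root i ?y = Suc j" by (simp only: j'(1))
        then have "j = 0" using root_y by simp
        then show False using z j'(2) by simp
      qed
      then have "j = 1" "z = vx (i + Suc j)" using root_vx[OF j(1), of i] root_y by auto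
      then have "f z = - t" using f_vx[of 2] n by (simp add: \<phi>_def numeral_2_eq_2)
      then show ?thesis using w_cycle[OF True] by simp
    next
      case False
      then have "root i z = 1" using root_edge[of ?y z i] root_y yz by simp
      then show ?thesis using hy(2)[OF yz] by (simp add: f_def \<phi>_def)
    qed
  qed (use fx fy wxy in auto)
  then show ?thesis by blast
qed

lemma edge_potential_exists:
  assumes "6 \<le> n" "{x, y} \<in> E"
  shows "\<exists>f. edge_potential E w x y f"
proof (cases "{x, y} \<in> C")
  case True
  then obtain i where "{x, y} = {vx i, vx (Suc i)}" by (rule cycle_edgeE)
  then have "x = vx i \<and> y = vx (Suc i) \<or> y = vx i \<and> x = vx (Suc i)"
    by (auto simp: doubleton_eq_iff)
  moreover obtain f where f: "edge_potential E w (vx i) (vx (Suc i)) f"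
    using edge_potential_cycle[OF assms(1)] by blast
  ultimately show ?thesis using edge_potential_swap[OF f] by blast
next
  case False
  then show ?thesis using edge_potential_bridge assms(2) by blast
qed

lemma lly_curvature:
  assumes "6 \<le> n" "{x, y} \<in> E"
  shows "has_lly_curvature V E w x y (- (\<Sum>e\<in>E. ricci_matrix E {x, y} e * w e) / w {x, y})"
proof -
  obtain f where "edge_potential E w x y f" using edge_potential_exists[OF assms] by blast
  with graph(1,2) w_pos assms(2) show ?thesis by (rule has_lly_curvature_potential)
qed

end

section \<open>Perron eigenvectors and automorphisms\<close>

text \<open>Irreducibility is connectivity of the line graph: any split of the edges into two
  classes is met by two edges sharing a vertex, and their matrix entry is the reciprocal of a
  positive degree.\<close>

lemma ricci_irreducible_symmetric:
  assumes G: "simple_graph V E" "connected_graph V E" and ne: "E \<noteq> {}"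
  shows "irreducible_symmetric E (ricci_matrix E)"
proof
  show "finite E" "E \<noteq> {}" using simple_graph_finite[OF G(1)] ne by auto
  show "ricci_matrix E e e' = ricci_matrix E e' e" for e e'
    by (auto simp: ricci_matrix_def Int_commute)
  show "0 \<le> ricci_matrix E e e'" if "e \<noteq> e'" for e e'
    using that by (auto simp: ricci_matrix_def intro!: sum_nonneg)
  show "irreducible_on E (ricci_matrix E)"
    unfolding irreducible_on_def
  proof (intro allI impI)
    fix S assume S: "S \<subseteq> E" "S \<noteq> {}" "S \<noteq> E"
    have "\<exists>e\<in>S. \<exists>e'\<in>E - S. e \<inter> e' \<noteq> {}"
    proof -
      obtain e e' where e: "e \<in> S" and e': "e' \<in> E - S" using S by blast
      obtain a where a: "a \<in> e" using e S(1) by (auto elim: simple_graph_edgeE[OF G(1)])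
      obtain b where b: "b \<in> e'" using e' by (auto elim: simple_graph_edgeE[OF G(1)])
      \<comment> \<open>If \<open>e'\<close> touches an edge of \<open>S\<close>, this is the
        required pair. Otherwise a walk from \<open>a\<close> to \<open>b\<close> must leave the
        vertices covered by \<open>S\<close>, and the edge by which it leaves is outside
        \<open>S\<close>.\<close>
      show ?thesis
      proof (cases "b \<in> \<Union> S")
        case False
        have "a \<in> V" "b \<in> V" using G(1) S(1) a b e e' by (auto simp: simple_graph_def)
        then have "linked E a b" by (rule connected_graph_linked[OF G(2)])
        moreover have "a \<in> \<Union> S" using a e by blast
        ultimately obtain u v where uv: "u \<in> \<Union> S" "v \<notin> \<Union> S" "{u, v} \<in> E"
          using False by (rule linked_crossing_edge)
        then have "{u, v} \<in> E - S" by blast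
        then show ?thesis using uv(1) by blast
      qed (use b e' in blast)
    qed
    then obtain e e' z where e: "e \<in> S" "e' \<in> E - S" and z: "z \<in> e" "z \<in> e'" by blast
    have "e' \<in> {e \<in> E. z \<in> e}" using e z by simp
    moreover have "finite {e \<in> E. z \<in> e}" using simple_graph_finite[OF G(1)] by simp
    ultimately have "degree E z > 0"
      unfolding card_incident[OF G(1), symmetric] card_gt_0_iff by blast
    moreover have "finite e" using e(1) S(1) G(1) by (auto elim: simple_graph_edgeE)
    ultimately have "(\<Sum>z\<in>e \<inter> e'. 1 / real (degree E z)) > 0"
      using z by (intro sum_pos2[of _ z]) auto
    moreover have "e \<noteq> e'" using e by blast
    ultimately have "ricci_matrix E e e' > 0" by (simp add: ricci_matrix_def)
    then show "\<exists>e\<in>S. \<exists>e'\<in>E - S. 0 < ricci_matrix E e e'" using e by blast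
  qed
qed

text \<open>\<open>GREATEST\<close> says nothing until a maximum is known to be attained; the
  Rayleigh maximum is an eigenvalue and bounds all others, so it is
  \<open>lambda_max E\<close>.\<close>

lemma perron_eigenvector_exists:
  assumes "simple_graph V E" "connected_graph V E" "E \<noteq> {}"
  shows "\<exists>w. perron_eigenvector E w"
proof -
  interpret irreducible_symmetric E "ricci_matrix E"
    by (rule ricci_irreducible_symmetric[OF assms])
  obtain \<mu> w where w: "\<forall>e\<in>E. w e > 0" "eigen \<mu> w"
    and max: "\<And>\<nu> v. eigen \<nu> v \<Longrightarrow> \<exists>e\<in>E. v e \<noteq> 0 \<Longrightarrow> \<nu> \<le> \<mu>"
    by (rule perron_exists) blast
  have "\<exists>e\<in>E. w e \<noteq> 0" using w(1) assms(3) by (metis all_not_in_conv less_irrefl)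
  then have pair: "ricci_eigenpair E \<mu> w" unfolding ricci_eigenpair_def using w(2) by blast
  have "lambda_max E = \<mu>"
    unfolding lambda_max_def
  proof (rule Greatest_equality)
    show "\<nu> \<le> \<mu>" if "\<exists>v. ricci_eigenpair E \<nu> v" for \<nu>
      using that max unfolding ricci_eigenpair_def by blast
  qed (use pair in blast)
  then show ?thesis using w(1) pair unfolding perron_eigenvector_def by blast
qed

lemma perron_eigenvector_unique:
  assumes "simple_graph V E" "connected_graph V E" "E \<noteq> {}"
    and "perron_eigenvector E w" "perron_eigenvector E w'"
  shows "\<exists>a>0. \<forall>e\<in>E. w' e = a * w e"
proof -
  interpret irreducible_symmetric E "ricci_matrix E"
    by (rule ricci_irreducible_symmetric[OF assms(1-3)])
  show ?thesis
    using assms(4,5) unfolding perron_eigenvector_def ricci_eigenpair_def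
    by (intro pos_eigenvector_unique[where \<mu> = "lambda_max E"]) auto
qed

text \<open>On a finite edge set an injective self-map is onto, so an automorphism can be given by
  preservation of edges in one direction, without an inverse.\<close>

lemma edge_image_bij:
  assumes G: "simple_graph V E" and inj: "inj_on \<phi> V" and edges: "\<And>e. e \<in> E \<Longrightarrow> \<phi> ` e \<in> E"
  shows "bij_betw ((`) \<phi>) E E"
proof -
  have "inj_on ((`) \<phi>) E"
  proof (rule inj_onI)
    fix e e' assume "e \<in> E" "e' \<in> E" "\<phi> ` e = \<phi> ` e'"
    then show "e = e'"
      using inj_on_image_eq_iff[OF inj, of e e'] G by (simp add: simple_graph_def)
  qed
  moreover have "(`) \<phi> ` E = E"
    using simple_graph_finite[OF G] edges calculation by (intro endo_inj_surj) auto
  ultimately show ?thesis by (simp add: bij_betw_def)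
qed

text \<open>The general codomain serves two instances: the constant 1 in \<open>nat\<close> shows
  that degrees are invariant, and the weight gives the incident sums in
  \<open>ricci_sum\<close>.\<close>

lemma incident_sum_automorphism:
  fixes h :: "'a set \<Rightarrow> 'b::comm_monoid_add"
  assumes G: "simple_graph V E" and inj: "inj_on \<phi> V" and edges: "\<And>e. e \<in> E \<Longrightarrow> \<phi> ` e \<in> E"
    and z: "z \<in> V"
  shows "(\<Sum>e | e \<in> E \<and> \<phi> z \<in> e. h e) = (\<Sum>e | e \<in> E \<and> z \<in> e. h (\<phi> ` e))"
proof (rule sum.reindex_bij_betw[symmetric])
  have bij: "bij_betw ((`) \<phi>) E E" by (rule edge_image_bij[OF G inj edges])
  have mem: "\<phi> z \<in> \<phi> ` e \<longleftrightarrow> z \<in> e" if "e \<in> E" for e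
    using inj_on_image_mem_iff[OF inj z, of e] G that by (simp add: simple_graph_def)
  have "(`) \<phi> ` {e \<in> E. z \<in> e} = {e \<in> E. \<phi> z \<in> e}"
  proof (intro equalityI subsetI)
    fix e' assume e': "e' \<in> {e \<in> E. \<phi> z \<in> e}"
    then obtain e where "e \<in> E" "e' = \<phi> ` e" using bij unfolding bij_betw_def by blast
    then show "e' \<in> (`) \<phi> ` {e \<in> E. z \<in> e}" using e' mem by blast
  qed (use edges in auto)
  then show "bij_betw ((`) \<phi>) {e \<in> E. z \<in> e} {e \<in> E. \<phi> z \<in> e}"
    using bij_betw_subset[OF bij, of "{e \<in> E. z \<in> e}"] by auto
qed

lemma ricci_sum_automorphism:
  assumes G: "simple_graph V E" and inj: "inj_on \<phi> V" and edges: "\<And>e. e \<in> E \<Longrightarrow> \<phi> ` e \<in> E"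
    and e: "e \<in> E"
  shows "(\<Sum>e'\<in>E. ricci_matrix E e e' * w (\<phi> ` e')) = (\<Sum>e'\<in>E. ricci_matrix E (\<phi> ` e) e' * w e')"
proof -
  have eV: "e \<subseteq> V" using G e by (simp add: simple_graph_def)
  have deg: "degree E (\<phi> z) = degree E z" if "z \<in> V" for z
    using incident_sum_automorphism[OF G inj edges that, of "\<lambda>_. 1::nat"]
    unfolding card_incident[OF G, symmetric] by simp
  have "(\<Sum>e'\<in>E. ricci_matrix E (\<phi> ` e) e' * w e') =
      (\<Sum>z\<in>\<phi> ` e. ((\<Sum>e' | e' \<in> E \<and> z \<in> e'. w e') - 2 * w (\<phi> ` e)) / real (degree E z))"
    by (rule ricci_sum[OF G edges[OF e]])
  also have "\<dots> = (\<Sum>z\<in>e. ((\<Sum>e' | e' \<in> E \<and> \<phi> z \<in> e'. w e') - 2 * w (\<phi> ` e)) / real (degree E (\<phi> z)))"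
    using inj_on_subset[OF inj eV] by (simp add: sum.reindex)
  also have "\<dots> = (\<Sum>z\<in>e. ((\<Sum>e' | e' \<in> E \<and> z \<in> e'. w (\<phi> ` e')) - 2 * w (\<phi> ` e)) / real (degree E z))"
  proof (intro sum.cong refl)
    fix z assume "z \<in> e"
    then have z: "z \<in> V" using eV by blast
    show "((\<Sum>e' | e' \<in> E \<and> \<phi> z \<in> e'. w e') - 2 * w (\<phi> ` e)) / real (degree E (\<phi> z)) =
      ((\<Sum>e' | e' \<in> E \<and> z \<in> e'. w (\<phi> ` e')) - 2 * w (\<phi> ` e)) / real (degree E z)"
      by (simp only: deg[OF z] incident_sum_automorphism[OF G inj edges z, of w])
  qed
  also have "\<dots> = (\<Sum>e'\<in>E. ricci_matrix E e e' * w (\<phi> ` e'))"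
    by (rule ricci_sum[OF G e, symmetric])
  finally show ?thesis ..
qed

text \<open>By uniqueness \<open>w\<close> is multiplied by a constant under an automorphism, and the constant is 1
  because the total weight is preserved.\<close>

lemma perron_eigenvector_automorphism:
  assumes G: "simple_graph V E" "connected_graph V E" "E \<noteq> {}"
    and inj: "inj_on \<phi> V" and edges: "\<And>e. e \<in> E \<Longrightarrow> \<phi> ` e \<in> E"
    and w: "perron_eigenvector E w" and e: "e \<in> E"
  shows "w (\<phi> ` e) = w e"
proof -
  have pos: "\<forall>e\<in>E. w e > 0"
    and eig: "\<forall>e\<in>E. (\<Sum>e'\<in>E. ricci_matrix E e e' * w e') = lambda_max E * w e"
    using w by (auto simp: perron_eigenvector_def ricci_eigenpair_def)
  have "perron_eigenvector E (\<lambda>e. w (\<phi> ` e))"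
    unfolding perron_eigenvector_def ricci_eigenpair_def
  proof (intro conjI ballI)
    show "\<exists>e\<in>E. w (\<phi> ` e) \<noteq> 0" using pos edges[OF e] e by (metis less_irrefl)
    show "(\<Sum>e'\<in>E. ricci_matrix E e e' * w (\<phi> ` e')) = lambda_max E * w (\<phi> ` e)" if "e \<in> E" for e
      using eig edges[OF that] by (simp add: ricci_sum_automorphism[OF G(1) inj edges that])
  qed (use pos edges in blast)
  then obtain a where a: "\<forall>e\<in>E. w (\<phi> ` e) = a * w e"
    using perron_eigenvector_unique[OF G w] by blast
  have "sum w E = (\<Sum>e\<in>E. w (\<phi> ` e))"
    by (rule sum.reindex_bij_betw[OF edge_image_bij[OF G(1) inj edges], symmetric])
  also have "\<dots> = a * sum w E" using a by (simp add: sum_distrib_left)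
  finally have "sum w E = a * sum w E" .
  moreover have "sum w E > 0" using pos G(3) simple_graph_finite[OF G(1)] by (intro sum_pos) auto
  ultimately have "a = 1" by simp
  then show ?thesis using a e by simp
qed

section \<open>Rotation of the cycle and its effect on the Perron eigenvector\<close>

context unicyclic_cycle
begin

lemma pendant_vertices_vx: "pendant_vertices V E c (vx i) = {v. linked F (vx i) v}"
proof (intro equalityI subsetI)
  fix v assume "v \<in> pendant_vertices V E c (vx i)"
  then obtain p where "is_path V F (vx i) v p" unfolding pendant_vertices_def by blast
  then show "v \<in> {v. linked F (vx i) v}" by (auto dest: is_path_linked)
next
  fix v assume "v \<in> {v. linked F (vx i) v}"
  then have "linked F (vx i) v" by simp
  then have "\<exists>p. is_path V F (vx i) v p"
    using vx_in_V by (rule linked_is_path) (use edge_subset in blast)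
  then show "v \<in> pendant_vertices V E c (vx i)" by (simp add: pendant_vertices_def)
qed

text \<open>Each vertex is moved by the isomorphism belonging to its own pendant tree. The trees
  partition \<open>V\<close> and go to trees with distinct roots, which gives injectivity; every
  edge lies either on the cycle or inside one tree.\<close>

lemma rotation_exists:
  assumes iso: "\<And>x y. x \<in> set c \<Longrightarrow> y \<in> set c \<Longrightarrow> rooted_isomorphic
    (pendant_vertices V E c x) (pendant_edges V E c x) x
    (pendant_vertices V E c y) (pendant_edges V E c y) y"
  obtains \<phi> where "inj_on \<phi> V" "\<And>e. e \<in> E \<Longrightarrow> \<phi> ` e \<in> E" "\<And>i. \<phi> (vx i) = vx (Suc i)"
proof -
  let ?P = "\<lambda>i. pendant_vertices V E c (vx i)" and ?Q = "\<lambda>i. pendant_edges V E c (vx i)"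
  have "vx i \<in> set c" for i using n_pos by simp
  then have "\<forall>i. \<exists>f. bij_betw f (?P i) (?P (Suc i)) \<and> f (vx i) = vx (Suc i) \<and>
      (\<forall>u\<in>?P i. \<forall>v\<in>?P i. {u, v} \<in> ?Q i \<longleftrightarrow> {f u, f v} \<in> ?Q (Suc i))"
    using iso unfolding rooted_isomorphic_def by blast
  then obtain f where f: "\<And>i. bij_betw (f i) (?P i) (?P (Suc i))" "\<And>i. f i (vx i) = vx (Suc i)"
    "\<And>i u v. u \<in> ?P i \<Longrightarrow> v \<in> ?P i \<Longrightarrow> {u, v} \<in> ?Q i \<longleftrightarrow> {f i u, f i v} \<in> ?Q (Suc i)"
    by metis
  define \<phi> where "\<phi> = (\<lambda>u. f (root 0 u) u)"
  have P: "u \<in> ?P (root 0 u)" if "u \<in> V" for u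
    using root_linked(2)[OF that, of 0] unfolding pendant_vertices_vx by simp
  have \<phi>P: "\<phi> u \<in> ?P (Suc (root 0 u))" if "u \<in> V" for u
    using f(1) P[OF that] unfolding \<phi>_def bij_betw_def by blast
  have \<phi>_vx: "\<phi> (vx i) = vx (Suc i)" for i
  proof -
    \<comment> \<open>The isomorphisms are chosen for all natural indices, and \<open>f i\<close>
      may differ from \<open>f (i + n)\<close>; \<open>\<phi>\<close> only uses reduced
      indices.\<close>
    have "root 0 (vx i) = i mod n" using root_vx[of "i mod n" 0] n_pos by simp
    then have "\<phi> (vx i) = f (i mod n) (vx (i mod n))" by (simp add: \<phi>_def)
    also have "\<dots> = vx (Suc (i mod n))" by (rule f(2))
    finally show ?thesis by (simp add: mod_Suc_eq)
  qed
  show ?thesis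
  proof (rule that[OF _ _ \<phi>_vx])
    show "inj_on \<phi> V"
    proof (rule inj_onI)
      fix u v assume uv: "u \<in> V" "v \<in> V" "\<phi> u = \<phi> v"
      have u': "linked F (vx (Suc (root 0 u))) (\<phi> u)" and v': "linked F (vx (Suc (root 0 v))) (\<phi> u)"
        using \<phi>P[OF uv(1)] \<phi>P[OF uv(2)] uv(3) unfolding pendant_vertices_vx by simp_all
      have "linked F (vx (Suc (root 0 u))) (vx (Suc (root 0 v)))"
        using u' linked_sym[OF v'] by (rule rtranclp_trans)
      then have "Suc (root 0 u) mod n = Suc (root 0 v) mod n" by (rule cycle_vertices_unlinked)
      then have "root 0 u = root 0 v"
        using root_linked(1)[OF uv(1), of 0] root_linked(1)[OF uv(2), of 0]
        by (auto simp: mod_Suc split: if_splits)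
      then show "u = v"
        using uv P[OF uv(1)] P[OF uv(2)] f(1)[of "root 0 u"]
        unfolding \<phi>_def bij_betw_def by (auto dest: inj_onD)
    qed
    fix e assume e: "e \<in> E"
    then obtain u v where uv: "e = {u, v}" using simple_graph_edgeE[OF graph(1)] by blast
    show "\<phi> ` e \<in> E"
    proof (cases "e \<in> C")
      case True
      then obtain i where "e = {vx i, vx (Suc i)}" by (rule cycle_edgeE)
      then have "\<phi> ` e = cycle_edge c (Suc i)" by (simp only: image_insert image_empty \<phi>_vx cycle_edge_def)
      then show ?thesis using cycle_edge_in_E by simp
    next
      case False
      define r where "r = root 0 u"
      have rv: "root 0 v = r" using root_edge[of u v 0] e False uv by (simp add: r_def)
      have "u \<in> V" "v \<in> V" using e uv edge_subset by auto
      then have P': "u \<in> ?P r" "v \<in> ?P r" using P[of u] P[of v] rv by (simp_all add: r_def)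
      then have "{u, v} \<in> ?Q r" using e False uv by (simp add: pendant_edges_def)
      then have "{f r u, f r v} \<in> ?Q (Suc r)" using f(3)[OF P'] by simp
      then show ?thesis using rv by (simp add: uv \<phi>_def r_def pendant_edges_def)
    qed
  qed
qed

lemma constant_on_cycle:
  assumes "\<And>i. w (cycle_edge c (Suc i)) = w (cycle_edge c i)" "e \<in> C"
  shows "w e = w (cycle_edge c 0)"
proof -
  have "w (cycle_edge c i) = w (cycle_edge c 0)" for i
    by (induction i) (simp_all add: assms(1))
  then show ?thesis using assms(2) by (auto simp: cycle_edges_def)
qed

text \<open>The perimeter is \<open>n * t\<close> because the \<open>n\<close> cycle edges are
  pairwise distinct; the common factor \<open>t\<close> then cancels.\<close>

lemma three_edge_condition_iff:
  assumes t: "t > 0" and w: "\<And>e. e \<in> C \<Longrightarrow> w e = t"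
  shows "three_edge_condition w c \<longleftrightarrow> 3 \<le> real n / 2"
proof -
  have "(\<Sum>e\<in>C. w e) = real n * t" by (simp add: w card_C)
  moreover have "w (cycle_edge c i) = t" for i by (rule w[OF cycle_edge_in_C])
  ultimately have "three_edge_condition w c \<longleftrightarrow> 3 * t \<le> real n * t / 2"
    using n_pos by (auto simp: three_edge_condition_def)
  also have "\<dots> \<longleftrightarrow> 3 * t \<le> (real n / 2) * t" by simp
  also have "\<dots> \<longleftrightarrow> 3 \<le> real n / 2" using t by (simp only: mult_le_cancel_right) simp
  finally show ?thesis .
qed

lemma edges_nonempty: "E \<noteq> {}"
  using cycle_edge_in_E by blast

lemma perron_eigenvector_constant_on_cycle:
  assumes iso: "\<And>x y. x \<in> set c \<Longrightarrow> y \<in> set c \<Longrightarrow> rooted_isomorphic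
      (pendant_vertices V E c x) (pendant_edges V E c x) x
      (pendant_vertices V E c y) (pendant_edges V E c y) y"
    and w: "perron_eigenvector E w" and e: "e \<in> C"
  shows "w e = w (cycle_edge c 0)"
proof -
  obtain \<phi> where \<phi>: "inj_on \<phi> V" "\<And>e. e \<in> E \<Longrightarrow> \<phi> ` e \<in> E" "\<And>i. \<phi> (vx i) = vx (Suc i)"
    using rotation_exists[OF iso] by blast
  have "\<phi> ` cycle_edge c i = cycle_edge c (Suc i)" for i
    by (simp only: image_insert image_empty \<phi>(3) cycle_edge_def)
  then have "w (cycle_edge c (Suc i)) = w (cycle_edge c i)" for i
    using perron_eigenvector_automorphism[OF graph(1,2) edges_nonempty \<phi>(1,2) w cycle_edge_in_E]
    by metis
  then show ?thesis using e by (rule constant_on_cycle)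
qed

text \<open>The curvature of an edge is minus the quotient of the Ricci matrix applied to
  \<open>w\<close> by \<open>w\<close> itself. The eigenvalue equation makes this quotient equal to
  \<open>lambda_max E\<close> at every edge.\<close>

lemma perron_eigenvector_einstein:
  assumes w: "perron_eigenvector E w" and t: "\<And>e. e \<in> C \<Longrightarrow> w e = t" and n: "6 \<le> n"
  shows "discrete_einstein V E w (- lambda_max E)"
proof -
  have pos: "w e > 0" if "e \<in> E" for e using w that by (simp add: perron_eigenvector_def)
  interpret cycle_constant_weight V E c w t
    by unfold_locales (simp_all add: pos t)
  have "has_lly_curvature V E w x y (- lambda_max E)" if xy: "{x, y} \<in> E" for x y
  proof -
    have "(\<Sum>e\<in>E. ricci_matrix E {x, y} e * w e) = lambda_max E * w {x, y}"
      using w xy by (simp add: perron_eigenvector_def ricci_eigenpair_def)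
    then show ?thesis using lly_curvature[OF n xy] pos[OF xy] by simp
  qed
  then show ?thesis using pos by (simp add: discrete_einstein_def)
qed

end

theorem corollary3p4:
  fixes V :: "'a set" and E :: "'a set set" and c :: "'a list" and g d :: nat
  assumes "regular_decorated_cycle V E c g d"
  shows "(\<exists>w. perron_eigenvector E w) \<and>
    (\<forall>w w'. perron_eigenvector E w \<longrightarrow> perron_eigenvector E w' \<longrightarrow>
       (\<exists>a>0. \<forall>e\<in>E. w' e = a * w e)) \<and>
    (\<forall>w. perron_eigenvector E w \<longrightarrow>
       (\<forall>e\<in>cycle_edges c. \<forall>e'\<in>cycle_edges c. w e = w e') \<and>
       (three_edge_condition w c \<longleftrightarrow> 3 \<le> real g / 2) \<and>
       (6 \<le> g \<longrightarrow> discrete_einstein V E w (- lambda_max E)))"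
proof -
  interpret unicyclic_cycle V E c
    using assms by unfold_locales (simp_all add: regular_decorated_cycle_def)
  have g: "length c = g" using assms by (simp add: regular_decorated_cycle_def)
  have iso: "rooted_isomorphic
      (pendant_vertices V E c x) (pendant_edges V E c x) x
      (pendant_vertices V E c y) (pendant_edges V E c y) y" if "x \<in> set c" "y \<in> set c" for x y
    using assms that by (simp add: regular_decorated_cycle_def)
  show ?thesis
  proof (intro conjI allI impI)
    show "\<exists>w. perron_eigenvector E w"
      by (rule perron_eigenvector_exists[OF graph(1,2) edges_nonempty])
    show "\<exists>a>0. \<forall>e\<in>E. w' e = a * w e" if "perron_eigenvector E w" "perron_eigenvector E w'" for w w'
      using that by (rule perron_eigenvector_unique[OF graph(1,2) edges_nonempty])
    fix w assume w: "perron_eigenvector E w"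
    have const: "w e = w (cycle_edge c 0)" if "e \<in> C" for e
      using perron_eigenvector_constant_on_cycle[OF iso w that] .
    then show "\<forall>e\<in>C. \<forall>e'\<in>C. w e = w e'" by simp
    have "w (cycle_edge c 0) > 0"
      using w cycle_edge_in_E by (simp add: perron_eigenvector_def)
    then show "three_edge_condition w c \<longleftrightarrow> 3 \<le> real g / 2"
      using three_edge_condition_iff const g by blast
    show "discrete_einstein V E w (- lambda_max E)" if "6 \<le> g"
      using perron_eigenvector_einstein[OF w const] that g by simp
  qed
qed

end
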